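(* Let $\mathbb{D}=\{z\in\mathbb{C}:|z|<1\}$, let $p$ be analytic in $\mathbb{D}$ with $p(0)=1$, and suppose that $1+\beta\, \dfrac{z p'(z)}{p^2(z)}\prec\sqrt{1+z}$. Then the following subordination results hold, with sharp bounds on $\beta$: (a) If $\beta\ge 4(1+\sqrt{2})(1-\log 2)\approx 2.96323$, then $p(z)\prec\varphi_0(z)$, where $\varphi_0(z)=1+\frac{z}{k}\cdot\frac{k+z}{k-z}$ with $k=\sqrt{2}+1$. (b) If $\beta\ge \dfrac{2(1+\sin(1))(\sqrt{2}-\log(1+\sqrt{2})+\log 2-1)}{\sin(1)}\approx 0.989098$, then $p(z)\prec 1+\sin z$. (c) If $\beta\ge (2+\sqrt{2})(\sqrt{2}-\log(1+\sqrt{2})+\log 2-1)\approx 0.771568$, then $p(z)\prec z+\sqrt{1+z^2}$. (d) Let $-1<B<A<1$ and $$A_0=\frac{2-\log 4-\sqrt{2}+\log(1+\sqrt{2})}{\sqrt{2}-\log(1+\sqrt{2})}\approx 0.151764.$$ If either (i) $A>A_0$ and $\beta\ge \dfrac{2(1-A)(1-\log 2)}{A-B}\approx 0.613706\,\dfrac{1-A}{A-B}$, or (ii) $A<A_0$ and $\beta\ge \dfrac{2(1+A)(\sqrt{2}-1+\log 2-\log(1+\sqrt{2}))}{A-B}\approx 0.451974\,\dfrac{1+A}{A-B}$, then $p(z)\prec \dfrac{1+Az}{1+Bz}$.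
   Context: For analytic functions $f,g$ on $\mathbb{D}$, $f$ is subordinate to $g$, written $f\prec g$ or $f(z)\prec g(z)$, if there is an analytic function $w:\mathbb{D}\to\mathbb{D}$ with $w(0)=0$ such that $f=g\circ w$. Here $\beta$ is a real number and $p^2(z)=(p(z))^2$. Square roots of functions denote the analytic branches on $\mathbb{D}$ taking the value $1$ at $z=0$, and $\log$ is the natural logarithm.
   Formalization: In (d) the conditions on A are interchanged: bound (i) is proved for A<A_0 and bound (ii) for A>A_0, because the printed version fails (e.g. A=1/2, B=0, β=2(1-log 2)). The decimal approximations are not part of the formal statement. *)

theory Defs
  imports "HOL-Analysis.Analysis"
begin

definition subordinate :: "(complex \<Rightarrow> complex) \<Rightarrow> (complex \<Rightarrow> complex) \<Rightarrow> bool"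
    (infix "\<prec>" 50) where
  "f \<prec> g \<longleftrightarrow>
     f holomorphic_on ball 0 1 \<and> g holomorphic_on ball 0 1 \<and>
     (\<exists>w. w holomorphic_on ball 0 1 \<and> w ` ball 0 1 \<subseteq> ball 0 1 \<and> w 0 = 0 \<and>
          (\<forall>z\<in>ball 0 1. f z = g (w z)))"

text \<open>
  The principal root \<open>csqrt\<close> has its branch cut on the negative real axis. For \<open>z\<close> in the unit
  disc, \<open>1 + z\<close> and \<open>1 + z\<^sup>2\<close> have positive real part, so \<open>csqrt (1 + z)\<close> and \<open>csqrt (1 + z\<^sup>2)\<close>
  are there the analytic branches taking the value 1 at 0.

  The convention \<open>x / 0 = 0\<close> is harmless below: if \<open>\<beta> \<noteq> 0\<close> and \<open>p\<close> had a zero in the disc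
  (necessarily not at 0), then \<open>z * deriv p z / (p z)\<^sup>2\<close> would be unbounded near it, which the
  holomorphy required by the subordination excludes.
\<close>

definition lemniscate_condition :: "real \<Rightarrow> (complex \<Rightarrow> complex) \<Rightarrow> bool" where
  "lemniscate_condition \<beta> p \<longleftrightarrow>
     p holomorphic_on ball 0 1 \<and> p 0 = 1 \<and>
     (\<lambda>z. 1 + of_real \<beta> * (z * deriv p z / (p z)\<^sup>2)) \<prec> (\<lambda>z. csqrt (1 + z))"

text \<open>
  Sharpness of the condition \<open>\<beta> \<ge> b\<close>: the implication fails for every positive \<open>\<beta>\<close> below \<open>b\<close>;
  hence, when \<open>b > 0\<close>, no constant smaller than \<open>b\<close> can replace \<open>b\<close>. Negative \<open>\<beta>\<close> have to be left
  out: for \<open>\<beta>\<close> negative and large in modulus the condition again forces \<open>p\<close> to be close to 1.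
\<close>

definition sharp_bound :: "real \<Rightarrow> (complex \<Rightarrow> complex) \<Rightarrow> bool" where
  "sharp_bound b \<phi> \<longleftrightarrow>
     (\<forall>\<beta> p. lemniscate_condition \<beta> p \<and> \<beta> \<ge> b \<longrightarrow> p \<prec> \<phi>) \<and>
     (\<forall>\<beta>. 0 < \<beta> \<and> \<beta> < b \<longrightarrow> (\<exists>p. lemniscate_condition \<beta> p \<and> \<not> p \<prec> \<phi>))"

definition phi0 :: "complex \<Rightarrow> complex" where
  "phi0 z = (let k = of_real (sqrt 2 + 1) in 1 + z / k * ((k + z) / (k - z)))"

text \<open>
  \<open>A0\<close> is the value of \<open>A\<close> at which \<open>2 (1 - A) (1 - ln 2)\<close> and
  \<open>2 (1 + A) (sqrt 2 - 1 + ln 2 - ln (1 + sqrt 2))\<close> agree. Subordination to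
  \<open>(1 + A z) / (1 + B z)\<close> needs \<open>\<beta> (A - B)\<close> to be at least the larger of the two, which is
  the first for \<open>A < A0\<close> and the second for \<open>A > A0\<close>. The source prints these two inequalities
  for \<open>A\<close> interchanged, and so attaches the smaller bound to each case. That version is false:
  for \<open>A = 1/2\<close>, \<open>B = 0\<close>, \<open>\<beta> = 2 (1 - ln 2)\<close>, take \<open>p = 1 / (1 - h / \<beta>)\<close> with
  \<open>h z = 2 (csqrt (1 + z) - 1 - Ln ((1 + csqrt (1 + z)) / 2))\<close>; it satisfies the hypothesis, but
  \<open>p x\<close> exceeds 3 for real \<open>x\<close> near 1, whereas \<open>1 + z / 2\<close> stays below \<open>3 / 2\<close> in modulus.
\<close>

definition A0 :: real where
  "A0 = (2 - ln 4 - sqrt 2 + ln (1 + sqrt 2)) / (sqrt 2 - ln (1 + sqrt 2))"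

end

theory Submission
  imports Defs "HOL-Complex_Analysis.Complex_Analysis"
begin

text \<open>
  Put \<open>u = \<beta> (1 - 1 / p)\<close>. The hypothesis says \<open>z u' = sqrt (1 + w) - 1\<close> for a Schwarz function \<open>w\<close>,
  so \<open>u\<close> is obtained by integrating \<open>(sqrt (1 + w (t z)) - 1) / t\<close> over \<open>0 < t < 1\<close>. By Schwarz's
  lemma \<open>|w (t z)| \<le> t |z|\<close>, and the image of the disc of radius \<open>r\<close> under \<open>sqrt (1 + z)\<close> lies in the
  disc having the real segment from \<open>sqrt (1 - r)\<close> to \<open>sqrt (1 + r)\<close> as a diameter. Both the centre and
  the radius of these discs can be integrated, so \<open>u\<close> takes values in the disc with diameter
  from \<open>h (- 1)\<close> to \<open>h 1\<close>, where \<open>h\<close> is the solution for \<open>w z = z\<close>. All four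
  superordinate functions only require this one disc: in each case the Schwarz function is
  written down explicitly. The bounds are sharp because \<open>p = 1 / (1 - h (r z) / \<beta>)\<close> is real on the
  real axis and leaves the image of the superordinate function through one of its real end points.
\<close>

lemma one_plus_notin_nonpos_Reals:
  fixes z :: complex
  assumes "norm z < 1"
  shows "1 + z \<notin> \<real>\<^sub>\<le>\<^sub>0"
  using assms abs_Re_le_cmod[of z] by (auto simp: complex_nonpos_Reals_iff)

lemma one_plus_csqrt_pos: "0 < Re (1 + csqrt z)" "1 + csqrt z \<noteq> 0"
proof -
  show "0 < Re (1 + csqrt z)"
    using Re_csqrt[of z] unfolding plus_complex.sel one_complex.sel by linarith
  then show "1 + csqrt z \<noteq> 0" by (metis less_irrefl zero_complex.sel(1))
qed

section \<open>Radial integration of the condition\<close>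

text \<open>With \<open>s\<close> the root of \<open>1 + t\<close>, whose derivative is
  \<open>1 / (2 * s)\<close>, the left side is what the chain rule yields for
  \<open>2 * (s - 1 - ln ((1 + s) / 2))\<close>. The generic field lets the real and the complex
  primitive share the simplification.\<close>

lemma lem_prim_derivative_eq:
  fixes s :: "'a :: field_char_0"
  assumes "s \<noteq> 0" "1 + s \<noteq> 0"
  shows "2 * (1 / (2 * s) - 1 / (2 * s) / 2 / ((1 + s) / 2)) = 1 / (1 + s)"
proof -
  define u where "u = 1 + s"
  have "2 * (1 / (2 * s) - 1 / (2 * s) / 2 / (u / 2)) = (u - 1) / (s * u)"
    using assms unfolding u_def[symmetric] by (simp add: divide_simps)
  also have "\<dots> = 1 / u"
    using assms by (simp add: u_def)
  finally show ?thesis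
    by (simp only: u_def)
qed

text \<open>Let \<open>s\<close> be the root, \<open>x\<close> its real part and \<open>q\<close>
  its squared modulus. The hypothesis on \<open>s\<^sup>2 - 1\<close> bounds \<open>x\<close> from
  below in terms of \<open>q\<close>, and membership in the disc with diameter from \<open>a\<close>
  to \<open>b\<close> amounts to \<open>q + a * b \<le> (a + b) * x\<close>.\<close>

lemma csqrt_one_plus_disc:
  assumes "norm z \<le> r" "r < 1"
  shows "norm (csqrt (1 + z) - of_real ((sqrt (1 + r) + sqrt (1 - r)) / 2))
           \<le> (sqrt (1 + r) - sqrt (1 - r)) / 2"
proof -
  define s where "s = csqrt (1 + z)"
  define x where "x = Re s"
  define q where "q = (norm s)\<^sup>2"
  define a where "a = sqrt (1 - r)"
  define b where "b = sqrt (1 + r)"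
  have r0: "0 \<le> r" using assms(1) norm_ge_zero order_trans by blast
  have a: "0 \<le> a" "a\<^sup>2 = 1 - r" and b: "0 \<le> b" "b\<^sup>2 = 1 + r" "a \<le> b"
    using r0 assms(2) by (auto simp: a_def b_def)
  have s2: "s\<^sup>2 = 1 + z" by (simp add: s_def)
  have x0: "0 \<le> x" unfolding x_def s_def by (rule Re_csqrt)
  have q: "q = x\<^sup>2 + (Im s)\<^sup>2" by (simp add: q_def x_def cmod_power2)
  have "(norm (s\<^sup>2 - 1))\<^sup>2 \<le> r\<^sup>2"
    using assms(1) s2 by (intro power_mono) auto
  moreover have "(norm (s\<^sup>2 - 1))\<^sup>2 = q\<^sup>2 + 2 * q - 4 * x\<^sup>2 + 1"
    unfolding cmod_power2 q x_def by (simp add: power2_eq_square algebra_simps)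
  ultimately have x2: "4 * x\<^sup>2 \<ge> (q + 1)\<^sup>2 - r\<^sup>2"
    by (simp add: power2_eq_square algebra_simps)
  have "\<bar>q - 1\<bar> \<le> r"
    using norm_triangle_ineq3[of "s\<^sup>2" 1] assms(1) s2
    unfolding q_def norm_power[symmetric] by simp
  then have q1: "(q - 1)\<^sup>2 \<le> r\<^sup>2"
    using r0 by (simp add: abs_le_square_iff[symmetric])
  define e where "e = a * b"
  have e2: "e\<^sup>2 = 1 - r\<^sup>2"
    unfolding e_def power_mult_distrib a b by (simp add: power2_eq_square algebra_simps)
  have e0: "0 \<le> e" "e \<le> 1"
    using a b e2 power2_le_imp_le[of e 1] by (auto simp: e_def)
  have ab2: "(a + b)\<^sup>2 = 2 + 2 * e"
    using a b by (simp add: e_def power2_sum)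
  \<comment> \<open>The lower bound for \<open>4 * x\<^sup>2\<close> is
    \<open>q\<^sup>2 + 2 * q + e\<^sup>2\<close>. Weighted by \<open>1 + e\<close> it exceeds
    \<open>2 * (q + e)\<^sup>2\<close> by \<open>(1 - e) * (2 * q - q\<^sup>2 - e\<^sup>2)\<close>,
    which is nonnegative by \<open>q1\<close> and \<open>e2\<close>.\<close>
  have "(q + e)\<^sup>2 \<le> ((a + b) * x)\<^sup>2"
  proof -
    have "0 \<le> (1 - e) * (2 * q - q\<^sup>2 - e\<^sup>2)"
      using q1 e2 e0 by (intro mult_nonneg_nonneg) (auto simp: power2_eq_square algebra_simps)
    moreover have "(1 + e) * (q\<^sup>2 + 2 * q + e\<^sup>2) \<le> (1 + e) * (4 * x\<^sup>2)"
    proof (rule mult_left_mono)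
      have "(q + 1)\<^sup>2 - r\<^sup>2 = q\<^sup>2 + 2 * q + e\<^sup>2"
        unfolding e2 by (simp add: power2_sum)
      then show "q\<^sup>2 + 2 * q + e\<^sup>2 \<le> 4 * x\<^sup>2" using x2 by simp
    qed (use e0 in simp)
    moreover have "2 * (q + e)\<^sup>2 = (1 + e) * (q\<^sup>2 + 2 * q + e\<^sup>2) - (1 - e) * (2 * q - q\<^sup>2 - e\<^sup>2)"
      by (simp add: power2_eq_square algebra_simps)
    ultimately have "2 * (q + e)\<^sup>2 \<le> (1 + e) * (4 * x\<^sup>2)" by linarith
    also have "\<dots> = 2 * ((2 + 2 * e) * x\<^sup>2)" by (simp add: algebra_simps)
    finally show ?thesis
      unfolding power_mult_distrib ab2 by simp
  qed
  then have main: "q + e \<le> (a + b) * x"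
    by (rule power2_le_imp_le) (intro mult_nonneg_nonneg add_nonneg_nonneg a(1) b(1) x0)
  have "(norm (s - of_real ((b + a) / 2)))\<^sup>2 = q - (a + b) * x + ((a + b) / 2)\<^sup>2"
    unfolding cmod_power2 q x_def by (simp add: power2_eq_square field_simps)
  also have "\<dots> \<le> ((b - a) / 2)\<^sup>2"
    using main by (simp add: e_def power2_eq_square field_simps)
  finally show ?thesis
    unfolding s_def[symmetric] a_def[symmetric] b_def[symmetric]
    by (rule power2_le_imp_le) (use b(3) in simp)
qed

text \<open>The solution of \<open>t h' = sqrt (1 + t) - 1\<close> with \<open>h 0 = 0\<close>.\<close>

definition lem_prim :: "real \<Rightarrow> real" where
  "lem_prim t = 2 * (sqrt (1 + t) - 1 - ln ((1 + sqrt (1 + t)) / 2))"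

definition clem_prim :: "complex \<Rightarrow> complex" where
  "clem_prim z = 2 * (csqrt (1 + z) - 1 - Ln ((1 + csqrt (1 + z)) / 2))"

lemma lem_prim_0 [simp]: "lem_prim 0 = 0"
  by (simp add: lem_prim_def)

lemma clem_prim_0 [simp]: "clem_prim 0 = 0"
  by (simp add: clem_prim_def)

text \<open>The root is not differentiable at -1, so continuity up to that end point is recorded
  separately. It carries monotonicity to the closed interval and supports the intermediate value
  arguments.\<close>

lemma continuous_on_lem_prim: "continuous_on {-1..1} lem_prim"
  unfolding lem_prim_def
proof (intro continuous_intros)
  show "\<forall>x\<in>{-1..1}. (1 + sqrt (1 + x)) / 2 \<noteq> (0::real)"
    by (auto simp: add_nonneg_eq_0_iff)
qed auto

lemma lem_prim_has_derivative:
  assumes "-1 < t"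
  shows "(lem_prim has_real_derivative 1 / (1 + sqrt (1 + t))) (at t)"
proof -
  define s where "s = sqrt (1 + t)"
  have s: "0 < s" using assms by (simp add: s_def)
  have d: "((\<lambda>t. sqrt (1 + t)) has_real_derivative 1 / (2 * s)) (at t)"
    unfolding s_def using assms by (auto intro!: derivative_eq_intros simp: field_simps)
  have "((\<lambda>t. (1 + sqrt (1 + t)) / 2) has_real_derivative 1 / (4 * s)) (at t)"
    using DERIV_cdivide[OF DERIV_add[OF DERIV_const[of 1] d], of 2] by simp
  moreover have "(ln has_real_derivative 1 / ((1 + s) / 2)) (at ((1 + sqrt (1 + t)) / 2))"
    using DERIV_ln_divide[of "(1 + s) / 2"] s by (simp add: s_def add_pos_pos)
  ultimately have "((\<lambda>t. ln ((1 + sqrt (1 + t)) / 2)) has_real_derivative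
      1 / ((1 + s) / 2) * (1 / (4 * s))) (at t)"
    by (rule DERIV_chain2[rotated])
  also have "1 / ((1 + s) / 2) * (1 / (4 * s)) = 1 / (2 * s) / 2 / ((1 + s) / 2)"
    using s by (simp only: times_divide_eq_left times_divide_eq_right divide_divide_eq_left) simp
  finally
  have "(lem_prim has_real_derivative
      2 * (1 / (2 * s) - 0 - 1 / (2 * s) / 2 / ((1 + s) / 2))) (at t)"
    unfolding lem_prim_def by (rule DERIV_cmult[OF DERIV_diff[OF DERIV_diff[OF d DERIV_const]]])
  also have "2 * (1 / (2 * s) - 0 - 1 / (2 * s) / 2 / ((1 + s) / 2)) = 1 / (1 + s)"
    using s by (subst lem_prim_derivative_eq[of s, symmetric]) simp_all
  finally show ?thesis by (simp add: s_def)
qed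

lemma strict_mono_on_lem_prim: "strict_mono_on {-1..1} lem_prim"
proof (rule strict_mono_onI)
  fix r s :: real assume rs: "r \<in> {-1..1}" "s \<in> {-1..1}" "r < s"
  show "lem_prim r < lem_prim s"
  proof (rule DERIV_pos_imp_increasing_open[OF rs(3)])
    fix x assume "r < x" "x < s"
    then have "-1 < x" using rs by auto
    then show "\<exists>y. DERIV lem_prim x :> y \<and> 0 < y"
      using lem_prim_has_derivative
      by (intro exI[of _ "1 / (1 + sqrt (1 + x))"]) (auto simp: add_pos_nonneg)
  next
    show "continuous_on {r..s} lem_prim"
      using continuous_on_lem_prim rs by (rule_tac continuous_on_subset) auto
  qed
qed

lemma lem_prim_less:
  assumes "-1 \<le> s" "s < t" "t \<le> 1"
  shows "lem_prim s < lem_prim t"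
  using strict_mono_onD[OF strict_mono_on_lem_prim, of s t] assms by auto

lemma clem_prim_of_real:
  assumes "-1 \<le> t"
  shows "clem_prim (of_real t) = of_real (lem_prim t)"
proof -
  have "csqrt (1 + of_real t) = of_real (sqrt (1 + t))"
    using of_real_sqrt[of "1 + t"] assms by simp
  moreover have "Ln (of_real ((1 + sqrt (1 + t)) / 2)) = of_real (ln ((1 + sqrt (1 + t)) / 2))"
    using assms by (intro Ln_of_real) (simp add: add_pos_nonneg)
  ultimately show ?thesis
    unfolding clem_prim_def lem_prim_def by simp
qed

lemma clem_prim_has_derivative:
  assumes "norm z < 1"
  shows "(clem_prim has_field_derivative 1 / (1 + csqrt (1 + z))) (at z)"
proof -
  define s where "s = csqrt (1 + z)"
  have nz: "1 + z \<notin> \<real>\<^sub>\<le>\<^sub>0" by (rule one_plus_notin_nonpos_Reals[OF assms])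
  then have s0: "s \<noteq> 0" by (auto simp: s_def)
  have re: "0 < Re (1 + s)" and s1: "1 + s \<noteq> 0"
    unfolding s_def by (rule one_plus_csqrt_pos)+
  have "(1 + s) / 2 \<notin> \<real>\<^sub>\<le>\<^sub>0" using re by (auto simp: complex_nonpos_Reals_iff)
  then have "(clem_prim has_field_derivative
      2 * (1 / (2 * s) - (1 / (2 * s) / 2) / ((1 + s) / 2))) (at z)"
    unfolding clem_prim_def s_def using nz
    by (auto intro!: derivative_eq_intros)
  also have "2 * (1 / (2 * s) - (1 / (2 * s) / 2) / ((1 + s) / 2)) = 1 / (1 + s)"
    by (rule lem_prim_derivative_eq[OF s0 s1])
  finally show ?thesis by (simp add: s_def)
qed

lemma holomorphic_on_clem_prim: "clem_prim holomorphic_on ball 0 1"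
  by (subst holomorphic_on_open) (auto intro!: exI clem_prim_has_derivative)

text \<open>Factoring \<open>z = (s - 1) * (1 + s)\<close> for the root \<open>s\<close> of
  \<open>1 + z\<close> cancels the derivative \<open>1 / (1 + s)\<close>. Hence
  \<open>clem_prim\<close> is the solution for the Schwarz function \<open>w z = z\<close>.\<close>

lemma clem_prim_ode:
  assumes "norm z < 1"
  shows "z * deriv clem_prim z = csqrt (1 + z) - 1"
proof -
  define s where "s = csqrt (1 + z)"
  have s1: "1 + s \<noteq> 0"
    unfolding s_def by (rule one_plus_csqrt_pos)
  have "z = (s - 1) * (1 + s)" using power2_csqrt[of "1 + z"]
    by (simp add: s_def power2_eq_square algebra_simps)
  then have "z * (1 / (1 + s)) = s - 1" using s1 by (simp add: field_simps)
  then show ?thesis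
    using DERIV_imp_deriv[OF clem_prim_has_derivative[OF assms]] by (simp add: s_def)
qed

text \<open>Along the ray \<open>t * z\<close>, \<open>f\<close> is the deviation of
  \<open>H\<close> from the moving centre and \<open>g\<close> is the moving radius. Schwarz's lemma
  and \<open>csqrt_one_plus_disc\<close> give \<open>norm (f' t) \<le> g' t\<close>. Both functions
  vanish at 0, so the mean value inequality replaces integration and gives the bound at
  \<open>t = 1\<close>.\<close>

lemma primitive_disc:
  assumes H: "H holomorphic_on ball 0 1" "H 0 = 0"
    and w: "w holomorphic_on ball 0 1" "w ` ball 0 1 \<subseteq> ball 0 1" "w 0 = 0"
    and ode: "\<And>z. norm z < 1 \<Longrightarrow> z * deriv H z = csqrt (1 + w z) - 1"
    and z: "norm z < 1"
  shows "norm (H z - of_real ((lem_prim (norm z) + lem_prim (- norm z)) / 2))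
           \<le> (lem_prim (norm z) - lem_prim (- norm z)) / 2"
proof -
  define r where "r = norm z"
  have r: "0 \<le> r" "r < 1" using z by (auto simp: r_def)
  define f where "f = (\<lambda>t. H (of_real t * z) - of_real ((lem_prim (t * r) + lem_prim (- t * r)) / 2))"
  define g where "g = (\<lambda>t. (lem_prim (t * r) - lem_prim (- t * r)) / 2)"
  define f' where "f' = (\<lambda>t. z * deriv H (of_real t * z) -
     of_real ((r / (1 + sqrt (1 + t * r)) - r / (1 + sqrt (1 - t * r))) / 2))"
  define g' where "g' = (\<lambda>t. (r / (1 + sqrt (1 + t * r)) + r / (1 + sqrt (1 - t * r))) / 2)"
  have tr: "\<bar>t * r\<bar> < 1" if "0 \<le> t" "t \<le> 1" for t
    using that r mult_left_le_one_le[of r t] by (simp add: abs_mult)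
  have tz: "norm (of_real t * z) < 1" if "0 \<le> t" "t \<le> 1" for t
    using tr[OF that] by (simp add: norm_mult r_def abs_mult)
  have cplus: "((\<lambda>t. lem_prim (t * r)) has_real_derivative r / (1 + sqrt (1 + t * r))) (at t)"
    and cminus: "((\<lambda>t. lem_prim (- t * r)) has_real_derivative - (r / (1 + sqrt (1 - t * r)))) (at t)"
    if "0 \<le> t" "t \<le> 1" for t
  proof -
    have bd: "-1 < t * r" "-1 < - t * r" using tr[OF that] by (simp_all only: abs_less_iff) simp_all
    show "((\<lambda>t. lem_prim (t * r)) has_real_derivative r / (1 + sqrt (1 + t * r))) (at t)"
      by (rule DERIV_cong[OF DERIV_chain2[where f = lem_prim and g = "\<lambda>t. t * r" and x = t,
          OF lem_prim_has_derivative[OF bd(1)] DERIV_cmult_right[OF DERIV_ident]]]) simp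
    show "((\<lambda>t. lem_prim (- t * r)) has_real_derivative - (r / (1 + sqrt (1 - t * r)))) (at t)"
      by (rule DERIV_cong[OF DERIV_chain2[where f = lem_prim and g = "\<lambda>t. - t * r" and x = t,
          OF lem_prim_has_derivative[OF bd(2)] DERIV_cmult_right[OF DERIV_minus[OF DERIV_ident]]]]) simp
  qed
  have df: "(f has_vector_derivative f' t) (at t)" if "0 \<le> t" "t \<le> 1" for t
  proof -
    have lin: "((\<lambda>t. of_real t * z) has_vector_derivative z) (at t)"
      unfolding has_vector_derivative_def
      by (auto intro!: derivative_eq_intros simp: scaleR_conv_of_real)
    have "(H has_field_derivative deriv H (of_real t * z)) (at (of_real t * z))"
      using H(1) tz[OF that] by (intro holomorphic_derivI[where S = "ball 0 1"]) auto
    then have "((\<lambda>t. H (of_real t * z)) has_vector_derivative z * deriv H (of_real t * z)) (at t)"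
      using field_vector_diff_chain_at[OF lin, of H] by (simp add: o_def)
    moreover have "((\<lambda>t. (lem_prim (t * r) + lem_prim (- t * r)) / 2) has_real_derivative
        (r / (1 + sqrt (1 + t * r)) - r / (1 + sqrt (1 - t * r))) / 2) (at t)"
      using DERIV_cdivide[OF DERIV_add[OF cplus[OF that] cminus[OF that]], of 2] by simp
    ultimately show ?thesis unfolding f_def f'_def
      by (intro has_vector_derivative_diff has_vector_derivative_of_real)
  qed
  have dg: "(g has_vector_derivative g' t) (at t)" if "0 \<le> t" "t \<le> 1" for t
    unfolding g_def g'_def has_real_derivative_iff_has_vector_derivative[symmetric]
    using DERIV_cdivide[OF DERIV_diff[OF cplus[OF that] cminus[OF that]], of 2] by simp
  have "norm (f 1 - f 0) \<le> g 1 - g 0"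
  proof (rule differentiable_bound_general[of 0 1 f g f' g'])
    show "continuous_on {0..1} f" "continuous_on {0..1} g"
      using df dg by (auto intro!: continuous_at_imp_continuous_on has_vector_derivative_continuous)
    fix t :: real assume t: "0 < t" "t < 1"
    define \<zeta> where "\<zeta> = of_real t * z"
    have \<zeta>: "norm \<zeta> = t * r" "norm \<zeta> < 1"
      using t tz[of t] by (auto simp: \<zeta>_def norm_mult r_def)
    have "norm (w \<zeta>) \<le> norm \<zeta>"
      using w \<zeta>(2) by (intro Schwarz_Lemma(1)) (auto simp: image_subset_iff)
    then have ws: "norm (csqrt (1 + w \<zeta>) - of_real ((sqrt (1 + t * r) + sqrt (1 - t * r)) / 2))
           \<le> (sqrt (1 + t * r) - sqrt (1 - t * r)) / 2"
      using \<zeta> by (intro csqrt_one_plus_disc) auto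
    \<comment> \<open>Rationalisation turns \<open>t\<close> times the derivatives of the real
      primitive into roots, so \<open>t * f' t\<close> and \<open>t * g' t\<close> become the
      deviation and the radius in \<open>ws\<close>. The factor \<open>t\<close> is positive and is
      cancelled at the end.\<close>
    have rat: "t * (r / (1 + sqrt (1 + t * r))) = sqrt (1 + t * r) - 1"
      "t * (r / (1 + sqrt (1 - t * r))) = 1 - sqrt (1 - t * r)"
      using tr[of t] t by (simp_all add: field_simps add_nonneg_eq_0_iff abs_less_iff)
    have rat': "t * (r / (1 + sqrt (1 + t * r)) - r / (1 + sqrt (1 - t * r))) / 2 
                  = (sqrt (1 + t * r) + sqrt (1 - t * r)) / 2 - 1"
      using rat by (simp add: right_diff_distrib diff_divide_distrib)
    have eq: "of_real t * f' t = csqrt (1 + w \<zeta>) - of_real ((sqrt (1 + t * r) + sqrt (1 - t * r)) / 2)"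
    proof -
      have "of_real t * f' t = \<zeta> * deriv H \<zeta> - of_real (t * (r / (1 + sqrt (1 + t * r)) - r / (1 + sqrt (1 - t * r))) / 2)"
        by (simp add: f'_def \<zeta>_def right_diff_distrib)
      then show ?thesis unfolding rat' using ode[OF \<zeta>(2)] by simp
    qed
    have "t * norm (f' t) = norm (of_real t * f' t)" using t by (simp add: norm_mult)
    also have "\<dots> \<le> (sqrt (1 + t * r) - sqrt (1 - t * r)) / 2" unfolding eq by (rule ws)
    also have "\<dots> = t * g' t" unfolding g'_def using rat by (simp add: distrib_left)
    finally show "norm (f' t) \<le> g' t" using t by simp
  qed (use df dg in auto)
  then show ?thesis using H(2) by (simp add: f_def g_def r_def)
qed


section \<open>Open discs with a real diameter\<close>

definition real_diameter_disc :: "real \<Rightarrow> real \<Rightarrow> complex set" where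
  "real_diameter_disc l u = ball (of_real ((l + u) / 2)) ((u - l) / 2)"

lemma mem_real_diameter_disc:
  "x \<in> real_diameter_disc l u \<longleftrightarrow> norm (x - of_real ((l + u) / 2)) < (u - l) / 2"
  unfolding real_diameter_disc_def by (simp add: dist_norm norm_minus_commute)

lemma norm_diff_real_midpoint_le:
  fixes x :: complex
  shows "norm (x - of_real ((l' + u') / 2)) \<le> norm (x - of_real ((l + u) / 2)) + \<bar>l' + u' - l - u\<bar> / 2"
proof -
  have "norm (x - of_real ((l' + u') / 2)) \<le> norm (x - of_real ((l + u) / 2))
      + norm (of_real ((l + u) / 2) - of_real ((l' + u') / 2) :: complex)"
    using norm_triangle_ineq[of "x - of_real ((l + u) / 2)" "of_real ((l + u) / 2) - of_real ((l' + u') / 2)"]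
    by simp
  also have "norm (of_real ((l + u) / 2) - of_real ((l' + u') / 2) :: complex)
      = \<bar>(l + u) / 2 - (l' + u') / 2\<bar>"
    by (metis norm_of_real of_real_diff)
  also have "\<dots> = \<bar>l' + u' - l - u\<bar> / 2"
    by (simp add: abs_if field_simps)
  finally show ?thesis by simp
qed

text \<open>The centre moves by half of \<open>\<bar>(u' - u) - (l - l')\<bar>\<close>, which is at
  most the growth \<open>((u' - u) + (l - l')) / 2\<close> of the radius.\<close>

lemma real_diameter_disc_mono:
  assumes "l' \<le> l" "u \<le> u'"
  shows "real_diameter_disc l u \<subseteq> real_diameter_disc l' u'"
proof
  fix x assume "x \<in> real_diameter_disc l u"
  moreover have "\<bar>l' + u' - l - u\<bar> \<le> (l - l') + (u' - u)"
    using assms by (simp add: abs_le_iff)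
  ultimately
  show "x \<in> real_diameter_disc l' u'"
    using norm_diff_real_midpoint_le[of x l' u' l u]
    unfolding mem_real_diameter_disc by (simp add: field_simps)
qed

text \<open>The quadratic expression is the real part of \<open>(x - l) * cnj (x - u)\<close>. By
  Thales, its sign tells whether the diameter is seen from \<open>x\<close> under an obtuse
  angle.\<close>

lemma mem_real_diameter_disc_iff:
  assumes "l \<le> u"
  shows "x \<in> real_diameter_disc l u \<longleftrightarrow> (norm x)\<^sup>2 - (l + u) * Re x + l * u < 0"
proof -
  have "x \<in> real_diameter_disc l u \<longleftrightarrow> (norm (x - of_real ((l + u) / 2)))\<^sup>2 < ((u - l) / 2)\<^sup>2"
    unfolding mem_real_diameter_disc using assms
    by (meson diff_ge_0_iff_ge divide_nonneg_nonneg norm_ge_zero power2_less_imp_less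
        power_strict_mono zero_less_numeral less_imp_le pos2)
  also have "(norm (x - of_real ((l + u) / 2)))\<^sup>2 = (norm x)\<^sup>2 - (l + u) * Re x + ((l + u) / 2)\<^sup>2"
    unfolding cmod_power2 by (simp add: power2_eq_square field_simps)
  also have "((u - l) / 2)\<^sup>2 = ((l + u) / 2)\<^sup>2 - l * u"
    by (simp add: power2_eq_square field_simps)
  finally show ?thesis
    by auto
qed

lemma Re_real_diameter_disc:
  assumes "x \<in> real_diameter_disc l u"
  shows "l < Re x" "Re x < u"
proof -
  have "\<bar>Re x - (l + u) / 2\<bar> < (u - l) / 2"
    using assms abs_Re_le_cmod[of "x - of_real ((l + u) / 2)"]
    unfolding mem_real_diameter_disc by simp
  then show "l < Re x" "Re x < u" by (auto simp: abs_less_iff field_simps)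
qed

lemma norm_real_diameter_disc_less:
  assumes "x \<in> real_diameter_disc l u" "- R \<le> l" "u \<le> R"
  shows "norm x < R"
  using assms real_diameter_disc_mono[of "- R" l u R]
  by (force simp: mem_real_diameter_disc subset_iff)

text \<open>The closed disc from \<open>primitive_disc\<close> depends on \<open>norm z\<close>.
  Strict monotonicity of \<open>lem_prim\<close> puts both ends of its diameter strictly inside the
  fixed one, which makes the fixed open disc suffice.\<close>

lemma primitive_mem_disc:
  assumes "H holomorphic_on ball 0 1" "H 0 = 0"
    and "w holomorphic_on ball 0 1" "w ` ball 0 1 \<subseteq> ball 0 1" "w 0 = 0"
    and "\<And>z. norm z < 1 \<Longrightarrow> z * deriv H z = csqrt (1 + w z) - 1"
    and z: "norm z < 1"
  shows "H z \<in> real_diameter_disc (lem_prim (- 1)) (lem_prim 1)"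
proof -
  have "norm (H z - of_real ((lem_prim (norm z) + lem_prim (- norm z)) / 2))
           \<le> (lem_prim (norm z) - lem_prim (- norm z)) / 2"
    by (rule primitive_disc[OF assms])
  moreover have "lem_prim (norm z) < lem_prim 1" "lem_prim (- 1) < lem_prim (- norm z)"
    using z by (auto intro!: lem_prim_less order_trans[OF _ norm_ge_zero])
  moreover from this have "\<bar>lem_prim (- 1) + lem_prim 1 - lem_prim (- norm z) - lem_prim (norm z)\<bar>
      < (lem_prim (- norm z) - lem_prim (- 1)) + (lem_prim 1 - lem_prim (norm z))"
    by (simp add: abs_less_iff)
  ultimately show ?thesis
    using norm_diff_real_midpoint_le[of "H z" "lem_prim (- 1)" "lem_prim 1"
        "lem_prim (- norm z)" "lem_prim (norm z)"]
    unfolding mem_real_diameter_disc by (simp add: field_simps)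
qed

text \<open>The zero of \<open>g\<close> at 0 makes \<open>g z / z\<close> analytic once
  \<open>deriv g 0\<close> is filled in. The convex disc then supplies a primitive, normalised by
  subtracting its value at 0.\<close>

lemma radial_primitive:
  assumes g: "g holomorphic_on ball 0 1" "g 0 = 0"
  obtains H where "H holomorphic_on ball 0 1" "H 0 = 0"
    "\<And>z. norm z < 1 \<Longrightarrow> z * deriv H z = g z"
proof -
  define G where "G = (\<lambda>z. if z = 0 then deriv g 0 else g z / z)"
  have "G holomorphic_on ball 0 1"
    by (rule pole_theorem_open_0[OF g(1), of 0]) (auto simp: G_def g)
  then obtain K where K: "\<And>z. z \<in> ball 0 1 \<Longrightarrow> (K has_field_derivative G z) (at z within ball 0 1)"
    using holomorphic_convex_primitive'[of "ball 0 1" G] by auto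
  define H where "H = (\<lambda>z. K z - K 0)"
  have dH: "(H has_field_derivative G z) (at z)" if "norm z < 1" for z
    using K[of z] that unfolding H_def
    by (auto intro!: derivative_eq_intros simp: at_within_open[of _ "ball 0 1"])
  show ?thesis
  proof
    show "H holomorphic_on ball 0 1"
      by (subst holomorphic_on_open) (auto intro!: exI dH)
    show "H 0 = 0" by (simp add: H_def)
    show "z * deriv H z = g z" if "norm z < 1" for z
      using DERIV_imp_deriv[OF dH[OF that]] g(2) by (simp add: G_def)
  qed
qed

text \<open>\<open>H\<close> is built from the Schwarz function alone, with no division by
  \<open>p\<close>, and so is analytic on the whole disc. Its relation to \<open>p\<close> is stated
  as a product because that form also shows that \<open>p\<close> has no zero.\<close>

lemma lemniscate_condition_primitive:
  assumes cond: "lemniscate_condition \<beta> p" and \<beta>: "\<beta> \<noteq> 0"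
  obtains H where "H holomorphic_on ball 0 1" "H 0 = 0"
    "\<And>z. norm z < 1 \<Longrightarrow> H z \<in> real_diameter_disc (lem_prim (- 1)) (lem_prim 1)"
    "\<And>z. norm z < 1 \<Longrightarrow> p z * (1 - H z / of_real \<beta>) = 1"
proof -
  from cond obtain w where p: "p holomorphic_on ball 0 1" "p 0 = 1"
    and w: "w holomorphic_on ball 0 1" "w ` ball 0 1 \<subseteq> ball 0 1" "w 0 = 0"
    and eq: "\<And>z. norm z < 1 \<Longrightarrow> 1 + of_real \<beta> * (z * deriv p z / (p z)\<^sup>2) = csqrt (1 + w z)"
    unfolding lemniscate_condition_def subordinate_def by auto
  have "(\<lambda>z. csqrt (1 + w z) - 1) holomorphic_on ball 0 1"
    using w by (intro holomorphic_intros one_plus_notin_nonpos_Reals) (auto simp: image_subset_iff)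
  then obtain H where H: "H holomorphic_on ball 0 1" "H 0 = 0"
    and ode: "\<And>z. norm z < 1 \<Longrightarrow> z * deriv H z = csqrt (1 + w z) - 1"
    using w(3) by (rule_tac radial_primitive[of "\<lambda>z. csqrt (1 + w z) - 1"]) auto
  have "continuous (at 0) p"
    using holomorphic_on_imp_continuous_on[OF p(1)] by (simp add: continuous_on_eq_continuous_at)
  then obtain d where d: "0 < d" "\<And>z. norm z < d \<Longrightarrow> p z \<noteq> 0"
    using continuous_at_avoid[of 0 p 0] p(2) by (auto simp: dist_norm)
  define e where "e = min d 1"
  have e: "0 < e" "ball 0 e \<subseteq> ball (0::complex) 1" "\<And>z. z \<in> ball 0 e \<Longrightarrow> p z \<noteq> 0"
    using d by (auto simp: e_def)
  define q where "q = (\<lambda>z. 1 / p z + H z / of_real \<beta>)"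
  have hol: "q holomorphic_on ball 0 e"
    unfolding q_def using e \<beta> holomorphic_on_subset[OF p(1) e(2)] holomorphic_on_subset[OF H(1) e(2)]
    by (intro holomorphic_intros) auto
  \<comment> \<open>The differential equations carry a factor \<open>z\<close>, which can be
    cancelled only off 0. The exceptional point is absorbed afterwards by the continuity of
    \<open>q\<close>.\<close>
  have dq: "(q has_field_derivative 0) (at z)" if z: "z \<in> ball 0 e - {0}" for z
  proof -
    have z': "norm z < 1" "z \<noteq> 0" "p z \<noteq> 0" using z e by auto
    have "(p has_field_derivative deriv p z) (at z)" "(H has_field_derivative deriv H z) (at z)"
      using p(1) H(1) z' by (auto intro!: holomorphic_derivI[where S = "ball 0 1"])
    then have "(q has_field_derivative - deriv p z / (p z)\<^sup>2 + deriv H z / of_real \<beta>) (at z)"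
      unfolding q_def using z' \<beta>
      by (auto intro!: derivative_eq_intros simp: power2_eq_square)
    moreover have "z * (- deriv p z / (p z)\<^sup>2 + deriv H z / of_real \<beta>) = 0"
    proof -
      have "z * deriv H z = of_real \<beta> * (z * deriv p z / (p z)\<^sup>2)"
        unfolding ode[OF z'(1)] eq[OF z'(1), symmetric] by simp
      then have "z * deriv H z / of_real \<beta> = z * deriv p z / (p z)\<^sup>2"
        using \<beta> by simp
      moreover have "z * (- deriv p z / (p z)\<^sup>2 + deriv H z / of_real \<beta>)
          = z * deriv H z / of_real \<beta> - z * deriv p z / (p z)\<^sup>2"
        by (simp add: algebra_simps)
      ultimately show ?thesis by (simp only: diff_self)
    qed
    ultimately show ?thesis using z' by simp
  qed
  obtain c where c: "\<And>z. z \<in> ball 0 e \<Longrightarrow> q z = c"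
    using DERIV_zero_connected_constant[of "ball 0 e" "{0}" q] dq
      holomorphic_on_imp_continuous_on[OF hol] by auto
  have "c = 1" using c[of 0] e(1) p(2) H(2) by (simp add: q_def)
  have near: "p z * (1 - H z / of_real \<beta>) = 1" if "z \<in> ball 0 e" for z
    using c[OF that] e(3)[OF that] unfolding \<open>c = 1\<close> q_def by (auto simp: field_simps)
  \<comment> \<open>The quotient defining the condition is a junk value at zeros of \<open>p\<close>, so this identity is
    first obtained near 0 and then continued; it rules out zeros afterwards.\<close>
  have "p z * (1 - H z / of_real \<beta>) = 1" if "norm z < 1" for z
    using near that e H(1) p(1) \<beta>
    by (intro analytic_continuation_open[of "ball 0 e" "ball 0 1"
          "\<lambda>z. p z * (1 - H z / of_real \<beta>)" "\<lambda>_. 1" z])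
      (auto intro!: holomorphic_intros)
  then show ?thesis
    using that[OF H] primitive_mem_disc[OF H w ode] by blast
qed

lemma clem_prim_mem_disc:
  assumes "norm z < 1"
  shows "clem_prim z \<in> real_diameter_disc (lem_prim (- 1)) (lem_prim 1)"
  by (rule primitive_mem_disc[OF holomorphic_on_clem_prim clem_prim_0 holomorphic_on_ident])
    (use assms clem_prim_ode in auto)

text \<open>This is the right end of the disc in \<open>primitive_disc\<close>. It keeps
  \<open>clem_prim (r * z)\<close> away from \<open>\<beta>\<close> when
  \<open>lem_prim r < \<beta>\<close>.\<close>

lemma Re_clem_prim_le:
  assumes "norm z < 1"
  shows "Re (clem_prim z) \<le> lem_prim (norm z)"
proof -
  have "norm (clem_prim z - of_real ((lem_prim (norm z) + lem_prim (- norm z)) / 2))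
           \<le> (lem_prim (norm z) - lem_prim (- norm z)) / 2"
    by (rule primitive_disc[OF holomorphic_on_clem_prim clem_prim_0 holomorphic_on_ident])
      (use assms clem_prim_ode in auto)
  then have "Re (clem_prim z - of_real ((lem_prim (norm z) + lem_prim (- norm z)) / 2))
           \<le> (lem_prim (norm z) - lem_prim (- norm z)) / 2"
    using complex_Re_le_cmod order_trans by blast
  then show ?thesis by (simp add: field_simps)
qed

section \<open>Extremal functions\<close>

text \<open>The Schwarz function behind it is \<open>r * z\<close>. For
  \<open>0 < \<beta> < lem_prim 1\<close> the choice \<open>r = 1\<close> would produce a pole
  inside the disc, and a small enough \<open>r\<close> moves it out.\<close>

definition extremal :: "real \<Rightarrow> real \<Rightarrow> complex \<Rightarrow> complex" where
  "extremal \<beta> r z = 1 / (1 - clem_prim (of_real r * z) / of_real \<beta>)"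

text \<open>The derivative of \<open>1 / (1 - H / \<beta>)\<close> divided by the square of that
  function is \<open>H' / \<beta>\<close>. The condition thus reduces to
  \<open>clem_prim_ode\<close> at \<open>r * z\<close>, and \<open>ne\<close> excludes
  poles.\<close>

lemma lemniscate_condition_extremal:
  assumes \<beta>: "\<beta> \<noteq> 0" and r: "0 < r" "r \<le> 1"
    and ne: "\<And>z. norm z < 1 \<Longrightarrow> clem_prim (of_real r * z) \<noteq> of_real \<beta>"
  shows "lemniscate_condition \<beta> (extremal \<beta> r)"
proof -
  define H where "H = (\<lambda>z. clem_prim (of_real r * z))"
  have rz: "norm (of_real r * z) < 1" if "norm z < 1" for z :: complex
    using that r mult_left_le_one_le[of "norm z" r] by (simp add: norm_mult)
  have dH: "(H has_field_derivative of_real r * deriv clem_prim (of_real r * z)) (at z)"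
    if "norm z < 1" for z
  proof -
    have "(clem_prim has_field_derivative deriv clem_prim (of_real r * z)) (at (of_real r * z))"
      using holomorphic_on_clem_prim rz[OF that] by (auto intro!: holomorphic_derivI[where S = "ball 0 1"])
    from DERIV_chain2[OF this DERIV_cmult[OF DERIV_ident]]
    show ?thesis unfolding H_def by (simp add: mult.commute)
  qed
  have nz: "1 - H z / of_real \<beta> \<noteq> 0" if "norm z < 1" for z
    using ne[OF that] \<beta> by (auto simp: H_def)
  have ext: "extremal \<beta> r = (\<lambda>z. 1 / (1 - H z / of_real \<beta>))"
    by (auto simp: extremal_def H_def)
  have dE: "(extremal \<beta> r has_field_derivative
      of_real r * deriv clem_prim (of_real r * z) / of_real \<beta> / (1 - H z / of_real \<beta>)\<^sup>2) (at z)"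
    if "norm z < 1" for z
    unfolding ext using dH[OF that] nz[OF that] \<beta>
    by (auto intro!: derivative_eq_intros simp: power2_eq_square)
  have eq: "1 + of_real \<beta> * (z * deriv (extremal \<beta> r) z / (extremal \<beta> r z)\<^sup>2) = csqrt (1 + of_real r * z)"
    if "norm z < 1" for z
  proof -
    have "of_real \<beta> * (z * deriv (extremal \<beta> r) z / (extremal \<beta> r z)\<^sup>2)
        = of_real r * z * deriv clem_prim (of_real r * z)"
      unfolding DERIV_imp_deriv[OF dE[OF that]] unfolding ext
      using nz[OF that] \<beta> by (simp add: power_divide)
    then show ?thesis using clem_prim_ode[OF rz[OF that]] by simp
  qed
  have hw: "(\<lambda>z. csqrt (1 + of_real r * z)) holomorphic_on ball 0 1"
    by (intro holomorphic_intros one_plus_notin_nonpos_Reals rz) auto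
  have "(\<lambda>z. 1 + of_real \<beta> * (z * deriv (extremal \<beta> r) z / (extremal \<beta> r z)\<^sup>2)) \<prec> (\<lambda>z. csqrt (1 + z))"
    unfolding subordinate_def
  proof (intro conjI exI[of _ "\<lambda>z. of_real r * z"] ballI)
    show "(\<lambda>z. 1 + of_real \<beta> * (z * deriv (extremal \<beta> r) z / (extremal \<beta> r z)\<^sup>2)) holomorphic_on ball 0 1"
      by (rule holomorphic_transform[OF hw]) (use eq in auto)
    show "(\<lambda>z. csqrt (1 + z)) holomorphic_on ball 0 1"
      by (intro holomorphic_intros one_plus_notin_nonpos_Reals) auto
  qed (use eq rz in \<open>auto intro!: holomorphic_intros\<close>)
  moreover have "extremal \<beta> r holomorphic_on ball 0 1"
    by (subst holomorphic_on_open) (auto intro!: exI dE)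
  ultimately show ?thesis
    unfolding lemniscate_condition_def by (simp add: extremal_def)
qed

lemma lem_prim_between:
  assumes "l < u" "0 < u" "l < lem_prim 1"
  obtains x where "0 < x" "x < 1" "l < lem_prim x" "lem_prim x < u"
proof -
  \<comment> \<open>Clipping the ends to 0 and \<open>lem_prim 1\<close> forces the preimage of the
    midpoint strictly between 0 and 1.\<close>
  define t where "t = (max l 0 + min u (lem_prim 1)) / 2"
  have "0 < lem_prim 1" using lem_prim_less[of 0 1] by simp
  then have t: "l < t" "0 < t" "t < u" "t < lem_prim 1" using assms by (auto simp: t_def)
  obtain x where x: "0 \<le> x" "x \<le> 1" "lem_prim x = t"
    using IVT'[of lem_prim 0 t 1] t continuous_on_subset[OF continuous_on_lem_prim, of "{0..1}"] by auto
  moreover have "x \<noteq> 0" "x \<noteq> 1" using x t by auto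
  ultimately show ?thesis using that[of x] t by auto
qed

text \<open>The value \<open>l = \<beta> * (1 - 1 / M)\<close> is where
  \<open>1 / (1 - l / \<beta>)\<close> equals \<open>M\<close>. A radius \<open>r\<close> with
  \<open>l < lem_prim r < \<beta>\<close> avoids the pole and still leaves room for
  \<open>x < r\<close> with \<open>l < lem_prim x\<close>; at \<open>x / r\<close> the extremal
  function is then real and beyond \<open>M\<close>.\<close>

lemma not_subordinate_right:
  assumes \<beta>: "0 < \<beta>" and M: "1 < M" "\<beta> * (1 - 1 / M) < lem_prim 1"
    and \<phi>: "\<And>w y. norm w < 1 \<Longrightarrow> M \<le> y \<Longrightarrow> \<phi> w \<noteq> of_real y"
  shows "\<exists>p. lemniscate_condition \<beta> p \<and> \<not> p \<prec> \<phi>"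
proof -
  define l where "l = \<beta> * (1 - 1 / M)"
  have l: "0 < l" "l < \<beta>" using \<beta> M by (simp_all add: l_def field_simps)
  obtain r where r: "0 < r" "r < 1" "l < lem_prim r" "lem_prim r < \<beta>"
    using lem_prim_between[of l \<beta>] l \<beta> M(2) by (auto simp: l_def)
  obtain x where x: "0 < x" "x < 1" "l < lem_prim x" "lem_prim x < lem_prim r"
    using lem_prim_between[of l "lem_prim r"] l r M(2) by (auto simp: l_def)
  have xr: "x < r"
    using x r lem_prim_less[of r x] by (cases x r rule: linorder_cases) auto
  have ne: "clem_prim (of_real r * z) \<noteq> of_real \<beta>" if "norm z < 1" for z
  proof
    assume "clem_prim (of_real r * z) = of_real \<beta>"
    moreover have nr: "norm (of_real r * z) < r" using that r by (simp add: norm_mult)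
    ultimately have "\<beta> \<le> lem_prim (norm (of_real r * z))"
      using Re_clem_prim_le[of "of_real r * z"] r by simp
    also have "\<dots> < lem_prim r"
      using nr r by (intro lem_prim_less) (auto intro: order_trans[OF _ norm_ge_zero])
    finally show False using r by simp
  qed
  have "\<not> extremal \<beta> r \<prec> \<phi>"
  proof
    assume "extremal \<beta> r \<prec> \<phi>"
    moreover have "of_real (x / r) \<in> ball (0::complex) 1"
      unfolding mem_ball_0 norm_of_real using x xr r by simp
    ultimately obtain w where w: "norm w < 1" "extremal \<beta> r (of_real (x / r)) = \<phi> w"
      unfolding subordinate_def by (force simp: image_subset_iff)
    have "extremal \<beta> r (of_real (x / r)) = of_real (1 / (1 - lem_prim x / \<beta>))"
      using r x by (simp add: extremal_def clem_prim_of_real del: of_real_divide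
          flip: of_real_mult) simp
    moreover have "M \<le> 1 / (1 - lem_prim x / \<beta>)"
    proof -
      have "l / \<beta> < lem_prim x / \<beta>" "lem_prim x / \<beta> < 1"
        using x r \<beta> by (auto simp: divide_strict_right_mono)
      moreover have "l / \<beta> = 1 - 1 / M" using \<beta> by (simp add: l_def)
      ultimately have "1 / M \<ge> 1 - lem_prim x / \<beta>" "0 < 1 - lem_prim x / \<beta>" by auto
      then show ?thesis using M by (simp add: field_simps)
    qed
    ultimately show False using \<phi>[OF w(1)] w(2) by metis
  qed
  then show ?thesis
    using lemniscate_condition_extremal[OF _ r(1) less_imp_le[OF r(2)] ne] \<beta> by auto
qed

text \<open>For \<open>\<beta> \<ge> lem_prim 1\<close> there is no pole, so \<open>r = 1\<close> is
  available and the argument can approach -1. Here \<open>l\<close> is the value of the primitive at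
  which the extremal function equals \<open>m\<close>, and \<open>t\<close> lies strictly between
  \<open>lem_prim (- 1)\<close> and \<open>l\<close>.\<close>

lemma not_subordinate_left_large:
  assumes \<beta>: "0 < \<beta>" "lem_prim 1 \<le> \<beta>" and m: "0 < m" "m < 1" "\<beta> * (1 / m - 1) < - lem_prim (- 1)"
    and \<phi>: "\<And>w y. norm w < 1 \<Longrightarrow> y \<le> m \<Longrightarrow> \<phi> w \<noteq> of_real y"
  shows "\<exists>p. lemniscate_condition \<beta> p \<and> \<not> p \<prec> \<phi>"
proof -
  define l where "l = - \<beta> * (1 / m - 1)"
  have l: "l < 0" "lem_prim (- 1) < l" using \<beta> m by (auto simp: l_def field_simps)
  define t where "t = (lem_prim (- 1) + l) / 2"
  have t: "lem_prim (- 1) < t" "t < l" using l by (auto simp: t_def)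
  obtain x where x: "- 1 \<le> x" "x \<le> 0" "lem_prim x = t"
    using IVT'[of lem_prim "- 1" t 0] l t continuous_on_subset[OF continuous_on_lem_prim, of "{- 1..0}"]
    by auto
  have x': "x \<noteq> - 1" "x \<noteq> 0" using x t l by auto
  have ne: "clem_prim (of_real 1 * z) \<noteq> of_real \<beta>" if "norm z < 1" for z
    using Re_real_diameter_disc(2)[OF clem_prim_mem_disc[OF that]] \<beta> by auto
  have "\<not> extremal \<beta> 1 \<prec> \<phi>"
  proof
    assume "extremal \<beta> 1 \<prec> \<phi>"
    moreover have "of_real x \<in> ball (0::complex) 1"
      unfolding mem_ball_0 norm_of_real using x x' by simp
    ultimately obtain w where w: "norm w < 1" "extremal \<beta> 1 (of_real x) = \<phi> w"
      unfolding subordinate_def by (force simp: image_subset_iff)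
    have "extremal \<beta> 1 (of_real x) = of_real (1 / (1 - lem_prim x / \<beta>))"
      using x by (simp add: extremal_def clem_prim_of_real)
    moreover have "1 / (1 - lem_prim x / \<beta>) \<le> m"
    proof -
      have "lem_prim x / \<beta> < l / \<beta>" using x t \<beta> by (auto simp: divide_strict_right_mono)
      moreover have "l / \<beta> = 1 - 1 / m" using \<beta> by (simp add: l_def)
      ultimately have "1 / m \<le> 1 - lem_prim x / \<beta>" by auto
      then have "inverse (1 - lem_prim x / \<beta>) \<le> inverse (1 / m)"
        using m by (intro le_imp_inverse_le) auto
      then show ?thesis by (simp add: divide_inverse)
    qed
    ultimately show False using \<phi>[OF w(1)] w(2) by metis
  qed
  then show ?thesis
    using lemniscate_condition_extremal[OF _ _ _ ne] \<beta> by auto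
qed

text \<open>A small \<open>\<beta>\<close> would give the left-hand example a pole. In that range
  the right end \<open>M\<close> is already exceeded, so the two cases cover every positive
  \<open>\<beta>\<close> below the bound.\<close>

lemma not_subordinate_left:
  assumes \<beta>: "0 < \<beta>" and m: "0 < m" "m < 1" "\<beta> * (1 / m - 1) < - lem_prim (- 1)" and M: "1 < M"
    and \<phi>: "\<And>w y. norm w < 1 \<Longrightarrow> y \<le> m \<or> M \<le> y \<Longrightarrow> \<phi> w \<noteq> of_real y"
  shows "\<exists>p. lemniscate_condition \<beta> p \<and> \<not> p \<prec> \<phi>"
proof (cases "\<beta> * (1 - 1 / M) < lem_prim 1")
  case True
  then show ?thesis using not_subordinate_right[OF \<beta> M] \<phi> by blast
next
  case False
  moreover have "\<beta> * (1 - 1 / M) \<le> \<beta>" using \<beta> M by (simp add: field_simps)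
  ultimately have "lem_prim 1 \<le> \<beta>" by linarith
  then show ?thesis using not_subordinate_left_large[OF \<beta> _ m] \<phi> by blast
qed

section \<open>Explicit Schwarz functions\<close>

lemma lem_prim_1: "lem_prim 1 = 2 * (sqrt 2 - ln (1 + sqrt 2) + ln 2 - 1)"
proof -
  have "0 < 1 + sqrt (2::real)" by (simp add: add_pos_pos)
  then show ?thesis unfolding lem_prim_def by (simp add: ln_div)
qed

lemma lem_prim_minus_1: "lem_prim (- 1) = - 2 * (1 - ln 2)"
  unfolding lem_prim_def by (simp add: ln_div)

lemma lem_prim_1_ge: "sqrt 2 - 1 \<le> lem_prim 1"
proof -
  have "ln ((1 + sqrt 2) / 2) \<le> (1 + sqrt 2) / 2 - 1"
    by (rule ln_le_minus_one) (simp add: add_pos_nonneg)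
  then show ?thesis unfolding lem_prim_def by (simp add: field_simps)
qed

lemma minus_lem_prim_minus_1_le: "- lem_prim (- 1) \<le> 2 / 3"
  unfolding lem_prim_minus_1 using ln2_ge_two_thirds by simp

lemma sqrt_2_bounds: "7 / 5 \<le> sqrt (2::real)" "sqrt (2::real) \<le> 10 / 7"
  by (rule real_le_rsqrt real_le_lsqrt; simp add: power2_eq_square)+

text \<open>Equivalent to \<open>ln (4 / (1 + sqrt 2)) \<le> 2 - sqrt 2\<close>, obtained from the
  quadratic Taylor bound for \<open>exp\<close>. It places the disc of values of \<open>H\<close>
  inside the disc about 0 of radius \<open>- lem_prim (- 1)\<close>.\<close>

lemma lem_prim_1_le: "lem_prim 1 \<le> - lem_prim (- 1)"
proof -
  define r :: real where "r = sqrt 2"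
  have r: "r * r = 2" "7 / 5 \<le> r" "r \<le> 10 / 7" using sqrt_2_bounds by (auto simp: r_def)
  have "4 / (1 + r) = 4 * (r - 1)" using r by (simp add: field_simps)
  also have "\<dots> \<le> 1 + (2 - r) + (2 - r)\<^sup>2 / 2" using r by (simp add: power2_eq_square field_simps)
  also have "\<dots> \<le> exp (2 - r)" using r by (intro exp_lower_Taylor_quadratic) auto
  finally have "ln (4 / (1 + r)) \<le> ln (exp (2 - r))" using r by (subst ln_le_cancel_iff) auto
  moreover have "ln (4 / (1 + r)) = 2 * ln 2 - ln (1 + r)"
    using r ln_realpow[of 2 2] by (simp add: ln_div)
  ultimately show ?thesis
    unfolding lem_prim_1 lem_prim_minus_1 by (simp add: r_def)
qed

lemma lem_prim_signs: "0 < lem_prim 1" "lem_prim (- 1) < 0"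
  using lem_prim_less[of 0 1] lem_prim_less[of "- 1" 0] by auto

section \<open>Schwarz functions for the four superordinate functions\<close>

lemma one_plus_real_mult_nonzero:
  fixes z :: complex
  assumes "\<bar>B\<bar> \<le> 1" "norm z < 1"
  shows "1 + of_real B * z \<noteq> 0"
proof
  assume "1 + of_real B * z = 0"
  then have "norm (of_real B * z) = 1" by (metis add_eq_0_iff norm_minus_cancel norm_one)
  moreover have "\<bar>B\<bar> * norm z \<le> 1 * norm z" using assms by (intro mult_right_mono) auto
  ultimately show False using assms by (simp add: norm_mult)
qed

text \<open>Inverting the Moebius map at \<open>1 / (1 - H / \<beta>)\<close> gives
  \<open>w = H / (c - A * H)\<close> with \<open>c = \<beta> * (A - B)\<close>. Then
  \<open>w\<close> has modulus below 1 exactly on the disc with diameter from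
  \<open>- c / (1 - A)\<close> to \<open>c / (1 + A)\<close>, and \<open>left\<close> and
  \<open>right\<close> say that this disc contains the values of \<open>H\<close>.\<close>

lemma subordinate_moebius:
  assumes cond: "lemniscate_condition \<beta> p" and AB: "- 1 < B" "B < A" "A < 1"
    and left: "- lem_prim (- 1) * (1 - A) \<le> \<beta> * (A - B)"
    and right: "lem_prim 1 * (1 + A) \<le> \<beta> * (A - B)"
  shows "p \<prec> (\<lambda>z. (1 + of_real A * z) / (1 + of_real B * z))"
proof -
  define c where "c = \<beta> * (A - B)"
  have c0: "0 < c"
    using right AB lem_prim_signs(1) mult_pos_pos[of "lem_prim 1" "1 + A"] unfolding c_def by linarith
  then have \<beta>: "0 < \<beta>" using AB by (simp add: c_def zero_less_mult_iff)
  obtain H where H: "H holomorphic_on ball 0 1" "H 0 = 0"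
    and mem: "\<And>z. norm z < 1 \<Longrightarrow> H z \<in> real_diameter_disc (lem_prim (- 1)) (lem_prim 1)"
    and p: "\<And>z. norm z < 1 \<Longrightarrow> p z * (1 - H z / of_real \<beta>) = 1"
    using lemniscate_condition_primitive[OF cond] \<beta> by (metis less_irrefl)
  have less: "norm (H z) < norm (of_real c - of_real A * H z)" if z: "norm z < 1" for z
  proof -
    define l where "l = - c / (1 - A)"
    define u where "u = c / (1 + A)"
    have "l \<le> lem_prim (- 1)" "lem_prim 1 \<le> u"
      using left right AB by (auto simp: l_def u_def c_def field_simps)
    then have "H z \<in> real_diameter_disc l u"
      using mem[OF z] real_diameter_disc_mono by blast
    moreover have "l \<le> u" using c0 AB by (simp add: l_def u_def field_simps)
    ultimately have "(1 - A) * (1 + A) * ((norm (H z))\<^sup>2 - (l + u) * Re (H z) + l * u) < 0"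
      using AB by (simp add: mem_real_diameter_disc_iff mult_pos_neg)
    also have "(1 - A) * (1 + A) * ((norm (H z))\<^sup>2 - (l + u) * Re (H z) + l * u)
       = (1 - A) * (1 + A) * (norm (H z))\<^sup>2
         - ((1 + A) * ((1 - A) * l) + (1 - A) * ((1 + A) * u)) * Re (H z) + ((1 - A) * l) * ((1 + A) * u)"
      by (simp add: algebra_simps)
    also have "(1 - A) * l = - c" using AB by (simp add: l_def)
    also have "(1 + A) * u = c" using AB by (simp add: u_def)
    finally have "(norm (H z))\<^sup>2 < c\<^sup>2 - 2 * A * c * Re (H z) + A\<^sup>2 * (norm (H z))\<^sup>2"
      by (simp add: power2_eq_square algebra_simps)
    also have "\<dots> = (norm (of_real c - of_real A * H z))\<^sup>2"
      unfolding cmod_power2 by (simp add: power2_eq_square algebra_simps)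
    finally show ?thesis by (rule power2_less_imp_less) simp
  qed
  define w where "w = (\<lambda>z. H z / (of_real c - of_real A * H z))"
  have nz: "of_real c - of_real A * H z \<noteq> 0" if "norm z < 1" for z
    using less[OF that] by auto
  have wbd: "norm (w z) < 1" if "norm z < 1" for z
    using less[OF that] nz[OF that] by (simp add: w_def norm_divide)
  show ?thesis unfolding subordinate_def
  proof (intro conjI exI[of _ w] ballI)
    show "p holomorphic_on ball 0 1" using cond by (simp add: lemniscate_condition_def)
    show "(\<lambda>z. (1 + of_real A * z) / (1 + of_real B * z)) holomorphic_on ball 0 1"
      using AB one_plus_real_mult_nonzero[of B] by (intro holomorphic_intros) auto
    show "w holomorphic_on ball 0 1"
      unfolding w_def using nz by (intro holomorphic_intros H) auto
    show "w ` ball 0 1 \<subseteq> ball 0 1" using wbd by auto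
    show "w 0 = 0" by (simp add: w_def H)
    fix z :: complex assume "z \<in> ball 0 1"
    then have z: "norm z < 1" by simp
    define D where "D = of_real c - of_real A * H z"
    have D: "D \<noteq> 0" "w z = H z / D" using nz[OF z] by (auto simp: D_def w_def)
    have h: "1 - H z / of_real \<beta> \<noteq> 0" using p[OF z] by auto
    have "(1 + of_real A * w z) / (1 + of_real B * w z) = (D + of_real A * H z) / (D + of_real B * H z)"
      unfolding D(2) using D(1) by (simp add: add_divide_eq_iff divide_add_eq_iff)
    also have "D + of_real A * H z = of_real c" by (simp add: D_def)
    also have "D + of_real B * H z = of_real c * (1 - H z / of_real \<beta>)"
      using \<beta> by (simp add: D_def c_def field_simps)
    also have "of_real c / (of_real c * (1 - H z / of_real \<beta>)) = 1 / (1 - H z / of_real \<beta>)"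
      using c0 by simp
    also have "\<dots> = p z" using p[OF z] h by (simp add: field_simps)
    finally show "p z = (1 + of_real A * w z) / (1 + of_real B * w z)" by simp
  qed
qed

text \<open>A differential inequality along the ray \<open>t * y\<close>: the derivative of
  \<open>Arcsin\<close> is the reciprocal of a root of \<open>1 - (t * y)\<^sup>2\<close>, whose
  modulus is smallest when \<open>(t * y)\<^sup>2\<close> is positive real.\<close>

lemma norm_Arcsin_le:
  assumes "norm y < 1"
  shows "norm (Arcsin y) \<le> arcsin (norm y)"
proof -
  define r where "r = norm y"
  have r: "0 \<le> r" "r < 1" using assms by (auto simp: r_def)
  have tr: "0 \<le> t * r" "t * r < 1" if "0 \<le> t" "t \<le> 1" for t
    using that r mult_left_le_one_le[of r t] by auto
  have "norm (Arcsin (of_real 1 * y) - Arcsin (of_real 0 * y)) \<le> arcsin (1 * r) - arcsin (0 * r)"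
  proof (rule differentiable_bound_general[of 0 1 "\<lambda>t. Arcsin (of_real t * y)" "\<lambda>t. arcsin (t * r)"
        "\<lambda>t. y * inverse (cos (Arcsin (of_real t * y)))" "\<lambda>t. inverse (sqrt (1 - (t * r)\<^sup>2)) * r"])
    have ty: "norm (of_real t * y) < 1" if "0 \<le> t" "t \<le> 1" for t
      using tr[OF that] that by (simp add: norm_mult r_def)
    have d1: "((\<lambda>t. Arcsin (of_real t * y)) has_vector_derivative
        y * inverse (cos (Arcsin (of_real t * y)))) (at t)" if "0 \<le> t" "t \<le> 1" for t
    proof -
      have "((\<lambda>t. of_real t * y) has_vector_derivative y) (at t)"
        unfolding has_vector_derivative_def
        by (auto intro!: derivative_eq_intros simp: scaleR_conv_of_real)
      moreover have "(Arcsin has_field_derivative inverse (cos (Arcsin (of_real t * y)))) (at (of_real t * y))"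
        using abs_Re_le_cmod[of "of_real t * y"] ty[OF that] by (intro has_field_derivative_Arcsin) linarith
      ultimately show ?thesis
        using field_vector_diff_chain_at[of "\<lambda>t. of_real t * y" y t Arcsin] by (simp add: o_def)
    qed
    have d2: "((\<lambda>t. arcsin (t * r)) has_vector_derivative inverse (sqrt (1 - (t * r)\<^sup>2)) * r) (at t)"
      if "0 \<le> t" "t \<le> 1" for t
      unfolding has_real_derivative_iff_has_vector_derivative[symmetric]
      using tr[OF that] DERIV_chain2[OF DERIV_arcsin DERIV_cmult_right[OF DERIV_ident], of t r] by simp
    show "continuous_on {0..1} (\<lambda>t. Arcsin (of_real t * y))" "continuous_on {0..1} (\<lambda>t. arcsin (t * r))"
      using d1 d2 by (auto intro!: continuous_at_imp_continuous_on has_vector_derivative_continuous)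
    fix t :: real assume "0 < t" "t < 1"
    then have t: "0 \<le> t" "t \<le> 1" by auto
    show "((\<lambda>t. Arcsin (of_real t * y)) has_vector_derivative
        y * inverse (cos (Arcsin (of_real t * y)))) (at t)" by (rule d1[OF t])
    show "((\<lambda>t. arcsin (t * r)) has_vector_derivative inverse (sqrt (1 - (t * r)\<^sup>2)) * r) (at t)"
      by (rule d2[OF t])
    have pos: "(t * r)\<^sup>2 < 1" using tr[OF t] by (simp add: abs_square_less_1)
    have "1 - (t * r)\<^sup>2 = norm (1::complex) - norm ((of_real t * y)\<^sup>2)"
      using t by (simp add: norm_mult norm_power r_def)
    also have "\<dots> \<le> norm (1 - (of_real t * y)\<^sup>2)" by (rule norm_triangle_ineq2)
    also have "1 - (of_real t * y)\<^sup>2 = (cos (Arcsin (of_real t * y)))\<^sup>2"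
      by (simp add: cos_squared_eq)
    finally have "sqrt (1 - (t * r)\<^sup>2) \<le> norm (cos (Arcsin (of_real t * y)))"
      by (simp add: real_le_lsqrt norm_power)
    then show "norm (y * inverse (cos (Arcsin (of_real t * y)))) \<le> inverse (sqrt (1 - (t * r)\<^sup>2)) * r"
      using pos r unfolding norm_mult norm_inverse r_def[symmetric] mult.commute[of r]
      by (intro mult_right_mono le_imp_inverse_le) auto
  qed simp
  then show ?thesis by (simp add: r_def)
qed

lemma sin_1_bounds: "1 / 2 < sin (1::real)" "sin (1::real) < 1"
proof -
  have "sin (pi / 6) < sin 1"
    using pi_less_4 pi_gt3 by (intro sin_monotone_2pi) auto
  then show "1 / 2 < sin (1::real)" by (simp add: sin_30)
  have "sin 1 < sin (pi / 2)"
    using pi_gt3 by (intro sin_monotone_2pi) auto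
  then show "sin (1::real) < 1" by simp
qed

text \<open>\<open>Arcsin\<close> maps the disc of radius \<open>sin 1\<close> into the unit disc,
  since \<open>arcsin (sin 1) = 1\<close>. The image of \<open>1 + sin z\<close> therefore contains
  the disc of radius \<open>sin 1\<close> about 1, the Moebius case \<open>A = sin 1\<close>,
  \<open>B = 0\<close>.\<close>

lemma subordinate_sin:
  assumes "p \<prec> (\<lambda>z. (1 + of_real (sin 1) * z) / (1 + of_real 0 * z))"
  shows "p \<prec> (\<lambda>z. 1 + sin z)"
proof -
  obtain w where p: "p holomorphic_on ball 0 1"
    and w: "w holomorphic_on ball 0 1" "w ` ball 0 1 \<subseteq> ball 0 1" "w 0 = 0"
    and eq: "\<And>z. norm z < 1 \<Longrightarrow> p z = 1 + of_real (sin 1) * w z"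
    using assms unfolding subordinate_def by auto
  define v where "v = (\<lambda>z. of_real (sin 1) * w z)"
  have v: "norm (v z) < sin 1" if "norm z < 1" for z
  proof -
    have "norm (w z) < 1" using w(2) that by (auto simp: image_subset_iff)
    then have "sin 1 * norm (w z) < sin 1 * 1"
      using sin_1_bounds by (intro mult_strict_left_mono) auto
    then show ?thesis using sin_1_bounds by (simp add: v_def norm_mult)
  qed
  have v1: "norm (v z) < 1" if "norm z < 1" for z
    using v[OF that] sin_1_bounds by simp
  have bd: "norm (Arcsin (v z)) < 1" if "norm z < 1" for z
  proof -
    have "norm (Arcsin (v z)) \<le> arcsin (norm (v z))" by (rule norm_Arcsin_le[OF v1[OF that]])
    also have "\<dots> < arcsin (sin 1)"
      using v[OF that] sin_1_bounds by (intro arcsin_less_arcsin) (auto intro: order_trans[OF _ norm_ge_zero])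
    also have "arcsin (sin 1) = (1::real)" using pi_gt3 by (intro arcsin_sin) auto
    finally show ?thesis .
  qed
  show ?thesis unfolding subordinate_def
  proof (intro conjI exI[of _ "\<lambda>z. Arcsin (v z)"] ballI)
    have "Arcsin holomorphic_on ball 0 1"
    proof (rule holomorphic_on_Arcsin)
      fix z :: complex assume "z \<in> ball 0 1" then show "\<bar>Re z\<bar> < 1"
        using abs_Re_le_cmod[of z] by simp
    qed
    moreover have "v holomorphic_on ball 0 1" unfolding v_def by (intro holomorphic_intros w)
    ultimately show "(\<lambda>z. Arcsin (v z)) holomorphic_on ball 0 1"
      using holomorphic_on_compose_gen[of v "ball 0 1" Arcsin "ball 0 1"] v1
      by (auto simp: o_def image_subset_iff)
    show "Arcsin (v 0) = 0" by (simp add: v_def w)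
  qed (use p bd eq in \<open>auto intro!: holomorphic_intros simp: v_def\<close>)
qed

text \<open>Solving for the argument gives \<open>w = (p - 1 / p) / 2\<close>. In terms of
  \<open>H\<close>, the difference of squares deciding \<open>norm (w z) < 1\<close> factors:
  \<open>H\<close> has to lie inside the circle of radius \<open>sqrt 2 * \<beta>\<close> about 0
  and outside the circle of the same radius about \<open>2 * \<beta>\<close>.\<close>

lemma subordinate_crescent:
  assumes cond: "lemniscate_condition \<beta> p" and \<beta>: "(2 + sqrt 2) / 2 * lem_prim 1 \<le> \<beta>"
  shows "p \<prec> (\<lambda>z. z + csqrt (1 + z\<^sup>2))"
proof -
  define r :: real where "r = sqrt 2"
  have r: "r * r = 2" "7 / 5 \<le> r" "r \<le> 10 / 7" using sqrt_2_bounds by (auto simp: r_def)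
  \<comment> \<open>The number \<open>\<beta> * (2 - sqrt 2)\<close> is the value of
    \<open>H\<close> at which \<open>1 / (1 - H / \<beta>)\<close> equals
    \<open>1 + sqrt 2\<close>.\<close>
  have h1: "lem_prim 1 \<le> \<beta> * (2 - r)"
  proof -
    have "(2 + r) / 2 * lem_prim 1 * (2 - r) \<le> \<beta> * (2 - r)"
      using \<beta> r by (intro mult_right_mono) (auto simp: r_def)
    moreover have "(2 + r) / 2 * lem_prim 1 * (2 - r) = (4 - r * r) / 2 * lem_prim 1"
      by (simp add: algebra_simps)
    ultimately have "(4 - r * r) / 2 * lem_prim 1 \<le> \<beta> * (2 - r)" by (simp only:)
    then show ?thesis unfolding r(1) by simp
  qed
  have b1: "1 \<le> r * \<beta>"
  proof -
    have "(r - 1) \<le> \<beta> * (2 - r)" using h1 lem_prim_1_ge by (simp add: r_def)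
    then have "(r - 1) * (2 + r) \<le> \<beta> * (2 - r) * (2 + r)" using r by (intro mult_right_mono) auto
    moreover have "\<beta> * (2 - r) * (2 + r) = \<beta> * (4 - r * r)" by (simp add: algebra_simps)
    ultimately have "r \<le> 2 * \<beta>" using r by (simp add: algebra_simps)
    then have "r * r \<le> r * (2 * \<beta>)" using r by (intro mult_left_mono) auto
    then show ?thesis using r by simp
  qed
  have \<beta>0: "0 < \<beta>" using b1 r zero_less_mult_pos[of r \<beta>] by linarith
  obtain H where H: "H holomorphic_on ball 0 1" "H 0 = 0"
    and mem: "\<And>z. norm z < 1 \<Longrightarrow> H z \<in> real_diameter_disc (lem_prim (- 1)) (lem_prim 1)"
    and p: "\<And>z. norm z < 1 \<Longrightarrow> p z * (1 - H z / of_real \<beta>) = 1"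
    using lemniscate_condition_primitive[OF cond] \<beta>0 by (metis less_irrefl)
  have p0: "p holomorphic_on ball 0 1" "p 0 = 1" using cond by (auto simp: lemniscate_condition_def)
  have pnz: "p z \<noteq> 0" if "norm z < 1" for z using p[OF that] by auto
  \<comment> \<open>Positivity passes to \<open>p\<close> and to \<open>(p + 1 / p) / 2\<close>,
    which identifies the latter as the principal root of \<open>1 + w\<^sup>2\<close>.\<close>
  have Rep: "0 < Re (1 / p z)" if z: "norm z < 1" for z
  proof -
    have "1 / p z = 1 - H z / of_real \<beta>" using p[OF z] pnz[OF z] by (simp add: field_simps)
    moreover have "\<beta> * (2 - r) < \<beta> * 1" using \<beta>0 r by (intro mult_strict_left_mono) auto
    then have "Re (H z) < \<beta>"
      using Re_real_diameter_disc(2)[OF mem[OF z]] h1 by linarith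
    ultimately show ?thesis using \<beta>0 by (simp add: Re_divide_of_real)
  qed
  define w where "w = (\<lambda>z. (p z - 1 / p z) / 2)"
  have wbd: "norm (w z) < 1" if z: "norm z < 1" for z
  proof -
    define x where "x = Re (H z)"
    define q where "q = (norm (H z))\<^sup>2"
    have x: "x < \<beta> * (2 - r)" using Re_real_diameter_disc(2)[OF mem[OF z]] h1 by (simp add: x_def)
    have "norm (H z) < 1"
      using mem[OF z] minus_lem_prim_minus_1_le lem_prim_1_le by (rule_tac norm_real_diameter_disc_less) auto
    then have "(norm (H z))\<^sup>2 < 1" by (simp add: abs_square_less_1)
    moreover have "1 \<le> (r * \<beta>)\<^sup>2" using b1 by (rule one_le_power)
    moreover have "(r * \<beta>)\<^sup>2 = 2 * \<beta>\<^sup>2"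
      unfolding power_mult_distrib by (simp add: r_def)
    ultimately have q: "q < 2 * \<beta>\<^sup>2" unfolding q_def by linarith
    have "x\<^sup>2 \<le> q" by (simp add: q_def x_def cmod_power2)
    \<comment> \<open>The two factors are those of
      \<open>x\<^sup>2 - 4 * \<beta> * x + 2 * \<beta>\<^sup>2\<close>, a lower bound for the second
      factor of the difference of squares.\<close>
    moreover have "0 < (\<beta> * (2 - r) - x) * (\<beta> * (2 + r) - x)"
    proof (rule mult_pos_pos)
      have "\<beta> * (2 - r) \<le> \<beta> * (2 + r)" using \<beta>0 r by (intro mult_left_mono) auto
      then show "0 < \<beta> * (2 + r) - x" using x by simp
    qed (use x in simp)
    moreover have "(\<beta> * (2 - r) - x) * (\<beta> * (2 + r) - x) = (4 - r * r) * \<beta>\<^sup>2 - 4 * \<beta> * x + x\<^sup>2"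
      by (simp add: power2_eq_square algebra_simps)
    ultimately have "0 < q + 2 * \<beta>\<^sup>2 - 4 * \<beta> * x" using r by simp
    then have "(q - 2 * \<beta>\<^sup>2) * (q + 2 * \<beta>\<^sup>2 - 4 * \<beta> * x) < 0" using q by (intro mult_neg_pos) auto
    moreover have "(norm (H z * (2 * of_real \<beta> - H z)))\<^sup>2 = q * (4 * \<beta>\<^sup>2 - 4 * \<beta> * x + q)"
    proof -
      have "(norm (2 * of_real \<beta> - H z))\<^sup>2 = 4 * \<beta>\<^sup>2 - 4 * \<beta> * x + q"
        unfolding cmod_power2 q_def x_def by (simp add: power2_eq_square algebra_simps)
      then show ?thesis by (simp only: norm_mult power_mult_distrib q_def)
    qed
    moreover have "(norm (2 * of_real \<beta> * (of_real \<beta> - H z)))\<^sup>2 = 4 * \<beta>\<^sup>2 * (\<beta>\<^sup>2 - 2 * \<beta> * x + q)"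
    proof -
      have "(norm (of_real \<beta> - H z))\<^sup>2 = \<beta>\<^sup>2 - 2 * \<beta> * x + q"
        unfolding cmod_power2 q_def x_def by (simp add: power2_eq_square algebra_simps)
      moreover have "(norm (2 * of_real \<beta> :: complex))\<^sup>2 = 4 * \<beta>\<^sup>2"
        by (simp add: norm_mult power_mult_distrib)
      ultimately show ?thesis unfolding norm_mult[of "2 * of_real \<beta>"] by (simp only: power_mult_distrib)
    qed
    moreover have "q * (4 * \<beta>\<^sup>2 - 4 * \<beta> * x + q) - 4 * \<beta>\<^sup>2 * (\<beta>\<^sup>2 - 2 * \<beta> * x + q)
        = (q - 2 * \<beta>\<^sup>2) * (q + 2 * \<beta>\<^sup>2 - 4 * \<beta> * x)"
      by (simp add: power2_eq_square algebra_simps)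
    ultimately have "(norm (H z * (2 * of_real \<beta> - H z)))\<^sup>2 < (norm (2 * of_real \<beta> * (of_real \<beta> - H z)))\<^sup>2"
      by linarith
    then have less: "norm (H z * (2 * of_real \<beta> - H z)) < norm (2 * of_real \<beta> * (of_real \<beta> - H z))"
      by (rule power2_less_imp_less) simp
    then have nz: "of_real \<beta> - H z \<noteq> 0" by auto
    have pz: "p z = of_real \<beta> / (of_real \<beta> - H z)"
      using p[OF z] nz \<beta>0 by (simp add: field_simps)
    have "w z = (H z * (2 * of_real \<beta> - H z)) / (2 * of_real \<beta> * (of_real \<beta> - H z))"
      unfolding w_def pz using nz \<beta>0 by (simp add: field_simps)
    then have "norm (w z) = norm (H z * (2 * of_real \<beta> - H z)) / norm (2 * of_real \<beta> * (of_real \<beta> - H z))"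
      by (simp only: norm_divide)
    also have "\<dots> < 1" using less nz \<beta>0 by (subst divide_less_eq_1_pos) auto
    finally show ?thesis .
  qed
  have hol: "(\<lambda>z. z + csqrt (1 + z\<^sup>2)) holomorphic_on ball 0 1"
    by (intro holomorphic_intros one_plus_notin_nonpos_Reals)
      (auto simp: norm_power abs_square_less_1)
  show ?thesis unfolding subordinate_def
  proof (intro conjI exI[of _ w] ballI)
    show "w holomorphic_on ball 0 1"
      unfolding w_def using pnz by (intro holomorphic_intros p0) auto
    show "w 0 = 0" by (simp add: w_def p0)
    fix z :: complex assume "z \<in> ball 0 1"
    then have z: "norm z < 1" by simp
    have "0 < Re (p z)" using Rep[OF z] by (simp add: Re_divide zero_less_divide_iff sum_power2_gt_zero_iff not_sum_power2_lt_zero)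
    then have pos: "0 < Re ((p z + 1 / p z) / 2)" using Rep[OF z] by simp
    have sq: "1 + (w z)\<^sup>2 = ((p z + 1 / p z) / 2)\<^sup>2"
      unfolding w_def using pnz[OF z] by (simp add: power2_eq_square field_simps)
    have "csqrt (1 + (w z)\<^sup>2) = (p z + 1 / p z) / 2"
      unfolding sq by (rule csqrt_square[OF disjI1[OF pos]])
    then show "p z = w z + csqrt (1 + (w z)\<^sup>2)" by (simp add: w_def field_simps)
  qed (use p0 hol wbd in auto)
qed

text \<open>With \<open>u = H / \<beta>\<close>, the equation \<open>phi0 w = 1 / (1 - u)\<close> is
  quadratic in \<open>w\<close>. The root vanishing at 0 is written as
  \<open>2 * k * u / (1 + s)\<close>, whose denominator has modulus at least 1.\<close>

lemma subordinate_phi0: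
  assumes cond: "lemniscate_condition \<beta> p" and \<beta>: "2 * (1 + sqrt 2) * - lem_prim (- 1) \<le> \<beta>"
  shows "p \<prec> phi0"
proof -
  define k :: real where "k = sqrt 2 + 1"
  have k: "k\<^sup>2 = 2 * k + 1" "1 < k" by (auto simp: k_def power2_eq_square algebra_simps)
  define a where "a = - lem_prim (- 1)"
  have a: "0 < a" "2 * k * a \<le> \<beta>" using lem_prim_signs \<beta> by (auto simp: a_def k_def algebra_simps)
  have \<beta>0: "0 < \<beta>" using a k mult_pos_pos[of "2 * k" a] by linarith
  obtain H where H: "H holomorphic_on ball 0 1" "H 0 = 0"
    and mem: "\<And>z. norm z < 1 \<Longrightarrow> H z \<in> real_diameter_disc (lem_prim (- 1)) (lem_prim 1)"
    and p: "\<And>z. norm z < 1 \<Longrightarrow> p z * (1 - H z / of_real \<beta>) = 1"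
    using lemniscate_condition_primitive[OF cond] \<beta>0 by (metis less_irrefl)
  define u where "u = (\<lambda>z. H z / of_real \<beta>)"
  have uhol: "u holomorphic_on ball 0 1" unfolding u_def using \<beta>0 by (intro holomorphic_intros H) auto
  have u: "norm (u z) < 1 / (2 * k)" if z: "norm z < 1" for z
  proof -
    have "norm (H z) < a"
      using mem[OF z] lem_prim_1_le by (rule_tac norm_real_diameter_disc_less) (auto simp: a_def)
    then have "2 * k * norm (H z) < 2 * k * a" using k by (intro mult_strict_left_mono) auto
    then have "2 * k * norm (H z) < \<beta>" using a by linarith
    then show ?thesis using k \<beta>0 by (simp add: u_def norm_divide field_simps)
  qed
  \<comment> \<open>Because \<open>k\<^sup>2 = 2 * k + 1\<close>, the radius
    \<open>1 / (2 * k)\<close> for \<open>u\<close> yields exactly 1 here. The critical point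
    \<open>u = - 1 / (2 * k)\<close> gives \<open>s = 0\<close> and \<open>w = - 1\<close>.\<close>
  have disc: "norm (4 * u z * (1 - u z)) < 1" if z: "norm z < 1" for z
  proof -
    have "norm (1 - u z) < 1 + 1 / (2 * k)"
      using norm_triangle_ineq4[of 1 "u z"] u[OF z] by simp
    then have "norm (u z) * norm (1 - u z) < 1 / (2 * k) * (1 + 1 / (2 * k))"
      using u[OF z] by (intro mult_strict_mono') auto
    also have "1 / (2 * k) * (1 + 1 / (2 * k)) = (2 * k + 1) / (4 * k\<^sup>2)"
      using k(2) by (simp add: field_simps power2_eq_square)
    also have "\<dots> = 1 / 4" using k by simp
    finally show ?thesis by (simp add: norm_mult)
  qed
  define s where "s = (\<lambda>z. csqrt (1 + 4 * u z * (1 - u z)))"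
  have shol: "s holomorphic_on ball 0 1"
    unfolding s_def by (intro holomorphic_intros uhol one_plus_notin_nonpos_Reals disc) auto
  have s1: "1 + s z \<noteq> 0" "1 \<le> norm (1 + s z)" for z
  proof -
    show "1 + s z \<noteq> 0" unfolding s_def by (rule one_plus_csqrt_pos)
    have "1 \<le> Re (1 + s z)" using Re_csqrt by (simp add: s_def del: csqrt.sel)
    then show "1 \<le> norm (1 + s z)" using complex_Re_le_cmod order_trans by blast
  qed
  define w where "w = (\<lambda>z. 2 * of_real k * u z / (1 + s z))"
  have wbd: "norm (w z) < 1" if z: "norm z < 1" for z
  proof -
    have "norm (w z) = 2 * k * norm (u z) / norm (1 + s z)"
      using k by (simp add: w_def norm_mult norm_divide)
    also have "\<dots> \<le> 2 * k * norm (u z) / 1" using s1[of z] k by (intro divide_left_mono) auto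
    also have "\<dots> < 1" using u[OF z] k by (simp add: field_simps)
    finally show ?thesis .
  qed
  have kz: "of_real k - z \<noteq> 0" if "norm z < 1" for z :: complex
    using that k by (metis abs_of_pos diff_eq_diff_eq eq_iff_diff_eq_0 less_asym norm_of_real order_less_trans zero_less_one)
  have kc: "(of_real k :: complex) \<noteq> 0" using k by simp
  show ?thesis unfolding subordinate_def
  proof (intro conjI exI[of _ w] ballI)
    show "p holomorphic_on ball 0 1" using cond by (simp add: lemniscate_condition_def)
    show "phi0 holomorphic_on ball 0 1"
      unfolding phi0_def Let_def k_def[symmetric] using kz kc by (intro holomorphic_intros) auto
    show "w holomorphic_on ball 0 1"
      unfolding w_def using s1 by (intro holomorphic_intros uhol shol) auto
    show "w 0 = 0" by (simp add: w_def u_def H)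
    show "w ` ball 0 1 \<subseteq> ball 0 1" using wbd by auto
    fix z :: complex assume "z \<in> ball 0 1"
    then have z: "norm z < 1" by simp
    define K :: complex where "K = of_real k"
    define D where "D = 1 + s z"
    define U where "U = u z"
    define W where "W = w z"
    have "(s z)\<^sup>2 = 1 + 4 * U * (1 - U)" by (simp add: s_def U_def)
    then have D2: "D\<^sup>2 = 2 * D + 4 * U * (1 - U)" unfolding D_def by (simp add: power2_eq_square algebra_simps)
    have WD: "W * D = 2 * K * U" using s1[of z] by (simp add: W_def w_def K_def D_def U_def)
    \<comment> \<open>Multiplying by the square of \<open>D\<close> leaves only \<open>W * D\<close>
      and \<open>D\<^sup>2\<close>, which \<open>WD\<close> and \<open>D2\<close> express through
      \<open>U\<close>; the root itself no longer occurs.\<close>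
    have "D\<^sup>2 * ((1 - U) * (K\<^sup>2 + W\<^sup>2) - (K\<^sup>2 - K * W))
        = (1 - U) * (W * D)\<^sup>2 + K * D * (W * D) - K\<^sup>2 * U * D\<^sup>2"
      by (simp add: power2_eq_square algebra_simps)
    also have "\<dots> = 0" unfolding WD D2 by (simp add: power2_eq_square algebra_simps)
    finally have key: "(1 - U) * (K\<^sup>2 + W\<^sup>2) = K\<^sup>2 - K * W" using s1[of z] by (simp add: D_def)
    have nz: "K \<noteq> 0" "K - W \<noteq> 0" using kc kz[OF wbd[OF z]] by (auto simp: K_def W_def)
    have "phi0 W = (K\<^sup>2 + W\<^sup>2) / (K * (K - W))"
      unfolding phi0_def Let_def k_def[symmetric] K_def[symmetric]
      using nz by (simp add: field_simps power2_eq_square)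
    then have "(1 - U) * phi0 W = (K\<^sup>2 - K * W) / (K * (K - W))" by (simp add: key)
    also have "\<dots> = 1" using nz by (simp add: power2_eq_square right_diff_distrib)
    finally have "p z * ((1 - U) * phi0 W) = p z" by simp
    then have "(p z * (1 - U)) * phi0 W = p z" by (simp only: mult.assoc)
    then show "p z = phi0 (w z)" using p[OF z] by (simp add: U_def u_def W_def)
  qed
qed

section \<open>Real values of the superordinate functions\<close>

text \<open>The two thresholds are the values of \<open>phi0\<close> at -1 and 1. Beyond the right
  one a comparison of moduli suffices, using \<open>k * (k - 1) = k + 1\<close>; beyond the left one
  real and imaginary parts are separated.\<close>

lemma phi0_not_real:
  assumes w: "norm w < 1" and y: "y \<le> 2 * sqrt 2 - 2 \<or> 2 \<le> y"
  shows "phi0 w \<noteq> of_real y"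
proof
  assume eq: "phi0 w = of_real y"
  define k :: real where "k = sqrt 2 + 1"
  have k: "k * k = 2 * k + 1" "1 < k" by (auto simp: k_def algebra_simps)
  define v where "v = y - 1"
  have kw: "of_real k - w \<noteq> 0"
    using w k by (metis abs_of_pos eq_iff_diff_eq_0 less_asym norm_of_real order_less_trans zero_less_one)
  have "w / of_real k * ((of_real k + w) / (of_real k - w)) = of_real v"
    using eq unfolding phi0_def Let_def k_def[symmetric] v_def by (simp add: algebra_simps)
  then have e: "w * (of_real k + w) = of_real (v * k) * (of_real k - w)"
    using kw k by (simp add: field_simps)
  show False
  proof (cases "2 \<le> y")
    case True
    have "norm w * norm (of_real k + w) \<le> 1 * (k + 1)"
      using w k norm_triangle_ineq[of "of_real k" w] by (intro mult_mono) auto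
    moreover have "k * (k - 1) < v * k * norm (of_real k - w)"
    proof -
      have "k - 1 < norm (of_real k - w)" using w k norm_triangle_ineq2[of "of_real k" w] by simp
      then have "k * (k - 1) < k * norm (of_real k - w)" using k by (intro mult_strict_left_mono) auto
      also have "\<dots> \<le> v * k * norm (of_real k - w)"
        using True k by (intro mult_right_mono) (auto simp: v_def)
      finally show ?thesis .
    qed
    moreover have "norm w * norm (of_real k + w) = v * k * norm (of_real k - w)"
    proof -
      have "norm w * norm (of_real k + w) = \<bar>v * k\<bar> * norm (of_real k - w)"
        using arg_cong[OF e, of norm] by (simp only: norm_mult norm_of_real)
      also have "\<bar>v * k\<bar> = v * k" using True k by (simp add: v_def)
      finally show ?thesis .
    qed
    ultimately have "k * (k - 1) < k + 1" by simp
    then show False using k by (simp add: algebra_simps)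
  next
    case False
    define a where "a = Re w"
    define b where "b = Im w"
    have ab: "a\<^sup>2 + b\<^sup>2 < 1" using w by (simp add: a_def b_def cmod_power2[symmetric] abs_square_less_1)
    \<comment> \<open>The threshold for \<open>v\<close> is
      \<open>2 * sqrt 2 - 3 = 2 * k - 5\<close>, and its product with
      \<open>k * k = 3 + 2 * sqrt 2\<close> is -1.\<close>
    have v: "v * (k * k) \<le> - 1"
    proof -
      have "v * (k * k) \<le> (2 * k - 5) * (k * k)"
        using y False k by (intro mult_right_mono) (auto simp: v_def k_def)
      also have "\<dots> = (2 * k - 5) * (2 * k + 1)" by (simp only: k(1))
      also have "\<dots> = 4 * (k * k) - 8 * k - 5" by (simp add: algebra_simps)
      finally show ?thesis using k by simp
    qed
    have re: "a * a - b * b + k * a = v * (k * k) - v * k * a"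
      using arg_cong[OF e, of Re] by (simp add: a_def b_def algebra_simps)
    \<comment> \<open>Either \<open>w\<close> is real, and the equation forces
      \<open>k * (a + 1)\<^sup>2 \<le> 0\<close>, or \<open>w\<close> is one of two conjugate roots,
      and their product gives squared modulus \<open>- v * k\<^sup>2 \<ge> 1\<close>.\<close>
    have "b * (2 * a + k * (1 + v)) = 0"
      using arg_cong[OF e, of Im] by (simp add: a_def b_def algebra_simps)
    then consider "b = 0" | "2 * a + k * (1 + v) = 0" by (auto simp only: mult_eq_0_iff)
    then show False
    proof cases
      case 1
      have a1: "- 1 < a" "a < 1" using ab 1 by (auto simp: abs_square_less_1)
      have "v * (k * k) * (k - a) \<le> - 1 * (k - a)" using v a1 k by (intro mult_right_mono) auto
      moreover have "v * (k * k) * (k - a) = k * (a * a + k * a)"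
      proof -
        have "a * a + k * a = v * (k * k) - v * k * a" using re 1 by simp
        moreover have "v * (k * k) * (k - a) = k * (v * (k * k) - v * k * a)"
          by (simp add: algebra_simps)
        ultimately show ?thesis by (simp only:)
      qed
      moreover have "k * (a * a + k * a) = k * (a * a) + (k * k) * a" by (simp add: algebra_simps)
      ultimately have "k * ((a + 1) * (a + 1)) \<le> 0" unfolding k(1) by (simp add: algebra_simps)
      moreover have "0 < k * ((a + 1) * (a + 1))" using a1 k by (intro mult_pos_pos) auto
      ultimately show False by simp
    next
      case 2
      have "k * a + v * k * a = a * (k * (1 + v))" by (simp add: algebra_simps)
      also have "k * (1 + v) = - 2 * a" using 2 by simp
      finally have "a * a + b * b = - (v * (k * k))" using re by simp
      then show False using v ab by (simp add: power2_eq_square)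
    qed
  qed
qed

text \<open>On the unit disc \<open>cos (Re w)\<close> is positive, so a real value of the sine
  forces \<open>w\<close> to be real; there the sine is increasing.\<close>

lemma one_plus_sin_not_real:
  assumes w: "norm (w::complex) < 1" and y: "1 + sin 1 \<le> y"
  shows "1 + sin w \<noteq> of_real y"
proof
  assume "1 + sin w = of_real y"
  then have eq: "sin w = of_real (y - 1)" by (simp add: algebra_simps)
  have Re: "\<bar>Re w\<bar> < 1" using w abs_Re_le_cmod[of w] by linarith
  then have "0 < cos (Re w)" using pi_gt3 by (intro cos_gt_zero_pi) auto
  moreover have "cos (Re w) * (exp (Im w) - exp (- Im w)) / 2 = 0"
    using arg_cong[OF eq, of Im] by (simp add: Im_sin)
  ultimately have "Im w = 0" by simp
  then have "w = of_real (Re w)" by (simp add: complex_eq_iff)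
  then have "sin w = of_real (sin (Re w))" by (metis sin_of_real)
  then have "sin (Re w) = y - 1" using eq by (metis of_real_eq_iff)
  moreover have "sin (Re w) < sin 1" using Re pi_gt3 by (intro sin_monotone_2pi) auto
  ultimately show False using y by simp
qed

lemma crescent_not_real:
  assumes w: "norm w < 1" and y: "1 + sqrt 2 \<le> y"
  shows "w + csqrt (1 + w\<^sup>2) \<noteq> of_real y"
proof
  assume "w + csqrt (1 + w\<^sup>2) = of_real y"
  then have "y \<le> norm (w + csqrt (1 + w\<^sup>2))" by (simp del: csqrt.sel)
  also have "\<dots> \<le> norm w + norm (csqrt (1 + w\<^sup>2))" by (rule norm_triangle_ineq)
  also have "norm (csqrt (1 + w\<^sup>2)) \<le> sqrt 2"
  proof (rule real_le_rsqrt)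
    have "(norm (csqrt (1 + w\<^sup>2)))\<^sup>2 = norm (1 + w\<^sup>2)" by (simp only: norm_power[symmetric] power2_csqrt)
    also have "\<dots> \<le> 1 + (norm w)\<^sup>2" by (rule order_trans[OF norm_triangle_ineq]) (simp add: norm_power)
    also have "\<dots> \<le> 2" using w by (simp add: abs_square_le_1)
    finally show "(norm (csqrt (1 + w\<^sup>2)))\<^sup>2 \<le> 2" .
  qed
  finally show False using w y by simp
qed

text \<open>Solving for \<open>w\<close> gives \<open>w * (A - B * y) = y - 1\<close>, hence
  \<open>\<bar>y - 1\<bar> < \<bar>A - B * y\<bar>\<close>. This fails from the values at -1 and 1
  outwards.\<close>

lemma moebius_not_real:
  assumes w: "norm (w::complex) < 1" and AB: "- 1 < B" "B < A" "A < 1"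
    and y: "y \<le> (1 - A) / (1 - B) \<or> (1 + A) / (1 + B) \<le> y"
  shows "(1 + of_real A * w) / (1 + of_real B * w) \<noteq> of_real y"
proof
  assume "(1 + of_real A * w) / (1 + of_real B * w) = of_real y"
  moreover have "1 + of_real B * w \<noteq> 0" using w AB by (intro one_plus_real_mult_nonzero) auto
  ultimately have "1 + of_real A * w = of_real y * (1 + of_real B * w)" by (simp add: field_simps)
  then have e: "w * of_real (A - B * y) = of_real (y - 1)" by (simp add: algebra_simps)
  have ne: "A - B * y \<noteq> 0"
  proof
    assume 0: "A - B * y = 0"
    then have "y = 1" using e by (simp del: of_real_diff)
    then show False using 0 AB by simp
  qed
  have "\<bar>y - 1\<bar> = norm w * \<bar>A - B * y\<bar>"
    using arg_cong[OF e, of norm] by (simp only: norm_mult norm_of_real)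
  also have "\<dots> < 1 * \<bar>A - B * y\<bar>" using w ne by (intro mult_strict_right_mono) auto
  finally have less: "\<bar>y - 1\<bar> < \<bar>A - B * y\<bar>" by simp
  from y show False
  proof
    assume "y \<le> (1 - A) / (1 - B)"
    then have 1: "y * (1 - B) \<le> 1 - A" using AB by (simp add: field_simps)
    also have "\<dots> < 1 * (1 - B)" using AB by simp
    finally have y1: "y < 1" using AB by (simp add: mult_less_cancel_right)
    then have "y * (1 + B) < 1 * (1 + B)" by (rule mult_strict_right_mono) (use AB in simp)
    also have "\<dots> < 1 + A" using AB by simp
    finally have "y * (1 + B) < 1 + A" .
    with 1 less y1 show False by (auto simp: algebra_simps abs_if split: if_splits)
  next
    assume "(1 + A) / (1 + B) \<le> y"
    then have 1: "1 + A \<le> y * (1 + B)" using AB by (simp add: field_simps)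
    have "1 * (1 + B) < 1 + A" using AB by simp
    also note 1
    finally have y1: "1 < y" using AB by (simp add: mult_less_cancel_right)
    have "1 - A < 1 * (1 - B)" using AB by simp
    also have "\<dots> < y * (1 - B)" using y1 by (rule mult_strict_right_mono) (use AB in simp)
    finally have "1 - A < y * (1 - B)" .
    with 1 less y1 show False by (auto simp: algebra_simps abs_if split: if_splits)
  qed
qed

section \<open>Sharp bounds\<close>

lemma sharp_boundI:
  assumes "\<And>\<beta> p. lemniscate_condition \<beta> p \<Longrightarrow> b \<le> \<beta> \<Longrightarrow> p \<prec> \<phi>"
    and "\<And>\<beta>. 0 < \<beta> \<Longrightarrow> \<beta> < b \<Longrightarrow> \<exists>p. lemniscate_condition \<beta> p \<and> \<not> p \<prec> \<phi>"
  shows "sharp_bound b \<phi>"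
  unfolding sharp_bound_def using assms by blast

lemma sharp_bound_phi0: "sharp_bound (4 * (1 + sqrt 2) * (1 - ln 2)) phi0"
proof (rule sharp_boundI)
  have b: "4 * (1 + sqrt 2) * (1 - ln 2) = 2 * (1 + sqrt 2) * - lem_prim (- 1)"
    by (simp add: lem_prim_minus_1 algebra_simps)
  show "p \<prec> phi0" if "lemniscate_condition \<beta> p" "4 * (1 + sqrt 2) * (1 - ln 2) \<le> \<beta>" for \<beta> p
    using subordinate_phi0[OF that(1)] that(2) unfolding b .
  fix \<beta> :: real assume \<beta>: "0 < \<beta>" "\<beta> < 4 * (1 + sqrt 2) * (1 - ln 2)"
  define r :: real where "r = sqrt 2"
  have r: "r * r = 2" "7 / 5 \<le> r" "r \<le> 10 / 7" using sqrt_2_bounds by (auto simp: r_def)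
  show "\<exists>p. lemniscate_condition \<beta> p \<and> \<not> p \<prec> phi0"
  proof (rule not_subordinate_left[OF \<beta>(1), of "2 * r - 2" 2])
    have "1 / (2 * r - 2) - 1 = (r - 1) / 2" using r by (simp add: field_simps)
    moreover have "\<beta> * ((r - 1) / 2) < 2 * (1 + r) * - lem_prim (- 1) * ((r - 1) / 2)"
      using \<beta>(2) r unfolding b by (intro mult_strict_right_mono) (auto simp: r_def)
    moreover have "2 * (1 + r) * - lem_prim (- 1) * ((r - 1) / 2) = (r * r - 1) * - lem_prim (- 1)"
      by (simp add: field_simps)
    ultimately have "\<beta> * (1 / (2 * r - 2) - 1) < (r * r - 1) * - lem_prim (- 1)" by (simp only:)
    then show "\<beta> * (1 / (2 * r - 2) - 1) < - lem_prim (- 1)" unfolding r(1) by simp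
  qed (use r phi0_not_real in \<open>auto simp: r_def\<close>)
qed

lemma sharp_bound_one_plus_sin:
  "sharp_bound (2 * (1 + sin 1) * (sqrt 2 - ln (1 + sqrt 2) + ln 2 - 1) / sin 1) (\<lambda>z. 1 + sin z)"
proof (rule sharp_boundI)
  define A :: real where "A = sin 1"
  have A: "1 / 2 < A" "A < 1" using sin_1_bounds by (auto simp: A_def)
  have b: "2 * (1 + sin 1) * (sqrt 2 - ln (1 + sqrt 2) + ln 2 - 1) / sin 1 = lem_prim 1 * (1 + A) / A"
    unfolding lem_prim_1 A_def by (simp only: mult.commute mult.left_commute)
  show "p \<prec> (\<lambda>z. 1 + sin z)" if "lemniscate_condition \<beta> p"
    "2 * (1 + sin 1) * (sqrt 2 - ln (1 + sqrt 2) + ln 2 - 1) / sin 1 \<le> \<beta>" for \<beta> p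
  proof (rule subordinate_sin[OF subordinate_moebius[OF that(1)]])
    have right: "lem_prim 1 * (1 + A) \<le> \<beta> * A" using that(2) A unfolding b by (simp add: field_simps)
    \<comment> \<open>For \<open>A = sin 1\<close> the right end is the binding one: the left
      requirement is at most \<open>1 / 3\<close>, below the lower bound \<open>sqrt 2 - 1\<close>
      for the right one.\<close>
    have "- lem_prim (- 1) * (1 - A) \<le> 2 / 3 * (1 / 2)"
      using A minus_lem_prim_minus_1_le by (intro mult_mono) auto
    also have "\<dots> \<le> (sqrt 2 - 1) * 1" using sqrt_2_bounds by simp
    also have "\<dots> \<le> lem_prim 1 * (1 + A)"
      using A lem_prim_1_ge sqrt_2_bounds by (intro mult_mono) auto
    finally show "- lem_prim (- 1) * (1 - sin 1) \<le> \<beta> * (sin 1 - 0)" using right by (simp add: A_def)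
    show "lem_prim 1 * (1 + sin 1) \<le> \<beta> * (sin 1 - 0)" using right by (simp add: A_def)
  qed (use A in \<open>auto simp: A_def\<close>)
  fix \<beta> :: real assume \<beta>: "0 < \<beta>" "\<beta> < 2 * (1 + sin 1) * (sqrt 2 - ln (1 + sqrt 2) + ln 2 - 1) / sin 1"
  show "\<exists>p. lemniscate_condition \<beta> p \<and> \<not> p \<prec> (\<lambda>z. 1 + sin z)"
  proof (rule not_subordinate_right[OF \<beta>(1), of "1 + A"])
    show "\<beta> * (1 - 1 / (1 + A)) < lem_prim 1" using \<beta>(2) A unfolding b by (simp add: field_simps)
  qed (use A one_plus_sin_not_real in \<open>auto simp: A_def\<close>)
qed

lemma sharp_bound_crescent:
  "sharp_bound ((2 + sqrt 2) * (sqrt 2 - ln (1 + sqrt 2) + ln 2 - 1)) (\<lambda>z. z + csqrt (1 + z\<^sup>2))"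
proof (rule sharp_boundI)
  have b: "(2 + sqrt 2) * (sqrt 2 - ln (1 + sqrt 2) + ln 2 - 1) = (2 + sqrt 2) / 2 * lem_prim 1"
    by (simp add: lem_prim_1)
  show "p \<prec> (\<lambda>z. z + csqrt (1 + z\<^sup>2))" if "lemniscate_condition \<beta> p"
    "(2 + sqrt 2) * (sqrt 2 - ln (1 + sqrt 2) + ln 2 - 1) \<le> \<beta>" for \<beta> p
    using subordinate_crescent[OF that(1)] that(2) unfolding b .
  fix \<beta> :: real assume \<beta>: "0 < \<beta>" "\<beta> < (2 + sqrt 2) * (sqrt 2 - ln (1 + sqrt 2) + ln 2 - 1)"
  define r :: real where "r = sqrt 2"
  have r: "r * r = 2" "7 / 5 \<le> r" "r \<le> 10 / 7" using sqrt_2_bounds by (auto simp: r_def)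
  show "\<exists>p. lemniscate_condition \<beta> p \<and> \<not> p \<prec> (\<lambda>z. z + csqrt (1 + z\<^sup>2))"
  proof (rule not_subordinate_right[OF \<beta>(1), of "1 + r"])
    have "1 - 1 / (1 + r) = 2 - r" using r by (simp add: field_simps)
    moreover have "\<beta> * (2 - r) < (2 + r) / 2 * lem_prim 1 * (2 - r)"
      using \<beta>(2) r unfolding b by (intro mult_strict_right_mono) (auto simp: r_def)
    moreover have "(2 + r) / 2 * lem_prim 1 * (2 - r) = (4 - r * r) / 2 * lem_prim 1"
      by (simp add: algebra_simps)
    ultimately have "\<beta> * (1 - 1 / (1 + r)) < (4 - r * r) / 2 * lem_prim 1" by (simp only:)
    then show "\<beta> * (1 - 1 / (1 + r)) < lem_prim 1" unfolding r(1) by simp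
  qed (use r crescent_not_real in \<open>auto simp: r_def simp del: csqrt.sel\<close>)
qed

text \<open>Up to a common factor 2, the numerator and denominator of \<open>A0\<close> are
  \<open>- lem_prim (- 1) - lem_prim 1\<close> and \<open>lem_prim 1 - lem_prim (- 1)\<close>.
  Comparing \<open>A\<close> with \<open>A0\<close> thus compares the two requirements of
  \<open>subordinate_moebius\<close>.\<close>

lemma A0_less_iff: "A < A0 \<longleftrightarrow> lem_prim 1 * (1 + A) < - lem_prim (- 1) * (1 - A)"
  and less_A0_iff: "A0 < A \<longleftrightarrow> - lem_prim (- 1) * (1 - A) < lem_prim 1 * (1 + A)"
proof -
  have "ln 4 = 2 * ln (2::real)" using ln_realpow[of 2 2] by simp
  then have n: "- lem_prim (- 1) - lem_prim 1 = 2 * (2 - ln 4 - sqrt 2 + ln (1 + sqrt 2))"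
    and d: "lem_prim 1 - lem_prim (- 1) = 2 * (sqrt 2 - ln (1 + sqrt 2))"
    unfolding lem_prim_1 lem_prim_minus_1 by simp_all
  have A0: "A0 = (- lem_prim (- 1) - lem_prim 1) / (lem_prim 1 - lem_prim (- 1))"
    unfolding A0_def n d by (rule mult_divide_mult_cancel_left[symmetric]) simp
  have pos: "0 < lem_prim 1 - lem_prim (- 1)" using lem_prim_signs by simp
  show "A < A0 \<longleftrightarrow> lem_prim 1 * (1 + A) < - lem_prim (- 1) * (1 - A)"
    "A0 < A \<longleftrightarrow> - lem_prim (- 1) * (1 - A) < lem_prim 1 * (1 + A)"
    unfolding A0 pos_less_divide_eq[OF pos] pos_divide_less_eq[OF pos] by (auto simp: algebra_simps)
qed

text \<open>Below \<open>A0\<close> the left requirement implies the right one. Sharpness comes from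
  the value at -1; the value at 1 is supplied for those small \<open>\<beta>\<close> that
  \<open>not_subordinate_left\<close> treats at the right end.\<close>

lemma sharp_bound_moebius_left:
  assumes AB: "- 1 < B" "B < A" "A < 1" and A0: "A < A0"
  shows "sharp_bound (2 * (1 - A) * (1 - ln 2) / (A - B)) (\<lambda>z. (1 + of_real A * z) / (1 + of_real B * z))"
proof (rule sharp_boundI)
  have b: "2 * (1 - A) * (1 - ln 2) / (A - B) = - lem_prim (- 1) * (1 - A) / (A - B)"
    by (simp add: lem_prim_minus_1 algebra_simps)
  show "p \<prec> (\<lambda>z. (1 + of_real A * z) / (1 + of_real B * z))" if "lemniscate_condition \<beta> p"
    "2 * (1 - A) * (1 - ln 2) / (A - B) \<le> \<beta>" for \<beta> p
  proof (rule subordinate_moebius[OF that(1) AB])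
    show "- lem_prim (- 1) * (1 - A) \<le> \<beta> * (A - B)"
      using that(2) AB unfolding b by (intro pos_divide_le_eq[THEN iffD1]) auto
    then show "lem_prim 1 * (1 + A) \<le> \<beta> * (A - B)"
      using A0 unfolding A0_less_iff by linarith
  qed
  fix \<beta> assume \<beta>: "0 < \<beta>" "\<beta> < 2 * (1 - A) * (1 - ln 2) / (A - B)"
  show "\<exists>p. lemniscate_condition \<beta> p \<and> \<not> p \<prec> (\<lambda>z. (1 + of_real A * z) / (1 + of_real B * z))"
  proof (rule not_subordinate_left[OF \<beta>(1), of "(1 - A) / (1 - B)" "(1 + A) / (1 + B)"])
    have "1 / ((1 - A) / (1 - B)) - 1 = (A - B) / (1 - A)" using AB by (simp add: field_simps)
    moreover have "\<beta> * (A - B) < - lem_prim (- 1) * (1 - A)"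
      using \<beta>(2) AB unfolding b by (intro pos_less_divide_eq[THEN iffD1]) auto
    then have "\<beta> * ((A - B) / (1 - A)) < - lem_prim (- 1)"
      using AB by (simp add: pos_divide_less_eq)
    ultimately show "\<beta> * (1 / ((1 - A) / (1 - B)) - 1) < - lem_prim (- 1)" by simp
  qed (use AB moebius_not_real in auto)
qed

text \<open>Above \<open>A0\<close> the right requirement implies the left one, and sharpness comes
  from the value at 1.\<close>

lemma sharp_bound_moebius_right:
  assumes AB: "- 1 < B" "B < A" "A < 1" and A0: "A0 < A"
  shows "sharp_bound (2 * (1 + A) * (sqrt 2 - 1 + ln 2 - ln (1 + sqrt 2)) / (A - B))
    (\<lambda>z. (1 + of_real A * z) / (1 + of_real B * z))"
proof (rule sharp_boundI)
  have b: "2 * (1 + A) * (sqrt 2 - 1 + ln 2 - ln (1 + sqrt 2)) / (A - B) = lem_prim 1 * (1 + A) / (A - B)"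
    by (simp add: lem_prim_1 algebra_simps)
  show "p \<prec> (\<lambda>z. (1 + of_real A * z) / (1 + of_real B * z))" if "lemniscate_condition \<beta> p"
    "2 * (1 + A) * (sqrt 2 - 1 + ln 2 - ln (1 + sqrt 2)) / (A - B) \<le> \<beta>" for \<beta> p
  proof (rule subordinate_moebius[OF that(1) AB])
    show "lem_prim 1 * (1 + A) \<le> \<beta> * (A - B)"
      using that(2) AB unfolding b by (simp add: pos_divide_le_eq)
    then show "- lem_prim (- 1) * (1 - A) \<le> \<beta> * (A - B)"
      using A0 unfolding less_A0_iff by linarith
  qed
  fix \<beta> assume \<beta>: "0 < \<beta>" "\<beta> < 2 * (1 + A) * (sqrt 2 - 1 + ln 2 - ln (1 + sqrt 2)) / (A - B)"
  show "\<exists>p. lemniscate_condition \<beta> p \<and> \<not> p \<prec> (\<lambda>z. (1 + of_real A * z) / (1 + of_real B * z))"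
  proof (rule not_subordinate_right[OF \<beta>(1), of "(1 + A) / (1 + B)"])
    have "1 - 1 / ((1 + A) / (1 + B)) = (A - B) / (1 + A)" using AB by (simp add: field_simps)
    moreover have "\<beta> * ((A - B) / (1 + A)) < lem_prim 1"
      using \<beta>(2) AB unfolding b by (simp add: pos_less_divide_eq pos_divide_less_eq)
    ultimately show "\<beta> * (1 - 1 / ((1 + A) / (1 + B))) < lem_prim 1" by simp
  qed (use AB moebius_not_real in auto)
qed

theorem theorem2p4:
  shows
    "sharp_bound (4 * (1 + sqrt 2) * (1 - ln 2)) phi0 \<and>
     sharp_bound (2 * (1 + sin 1) * (sqrt 2 - ln (1 + sqrt 2) + ln 2 - 1) / sin 1)
       (\<lambda>z. 1 + sin z) \<and>
     sharp_bound ((2 + sqrt 2) * (sqrt 2 - ln (1 + sqrt 2) + ln 2 - 1))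
       (\<lambda>z. z + csqrt (1 + z\<^sup>2)) \<and>
     (\<forall>A B :: real. -1 < B \<and> B < A \<and> A < 1 \<longrightarrow>
       (A < A0 \<longrightarrow>
          sharp_bound (2 * (1 - A) * (1 - ln 2) / (A - B))
            (\<lambda>z. (1 + of_real A * z) / (1 + of_real B * z))) \<and>
       (A > A0 \<longrightarrow>
          sharp_bound (2 * (1 + A) * (sqrt 2 - 1 + ln 2 - ln (1 + sqrt 2)) / (A - B))
            (\<lambda>z. (1 + of_real A * z) / (1 + of_real B * z))))"
  using sharp_bound_phi0 sharp_bound_one_plus_sin sharp_bound_crescent
    sharp_bound_moebius_left sharp_bound_moebius_right by blast

end
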